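(* Let $\Sigma$ be a CoLF signature. For any rational terms $M$ and $M'$ (terms all of whose recursion constants are declared in $\Sigma$), any list of distinct variables $\Theta$ and any finite list of assumptions $\Delta$, it is decidable whether the equality judgment $\Delta;\Theta\vdash_\Sigma M = M'$ is derivable.
   Context: CoLF syntax. A signature $\Sigma$ is a list of declarations $a:K$ (type families), $c:A$ (constructors) and $r:A=M$ (recursion constants with their definitions; definitions may mention recursion constants declared anywhere in $\Sigma$). Kinds $K::=\mathsf{type}\mid\mathsf{cotype}\mid \Pi x{:}A.\,K\mid \Pi x\,\hat{:}\,A.\,K$; types $A::=P\mid \Pi x{:}A_2.\,A_1\mid \Pi x\,\hat{:}\,A_2.\,A_1$ (the $\hat{:}$ forms are prepattern $\Pi$'s); atomic types $P::=a\cdot S$; canonical terms $M::=R\mid \lambda x.\,M$; neutral terms $R::=H\cdot S$; heads $H::=x\mid c\mid r$; spines $S::=()\mid M;S\mid [x];S$, where $[x]$ is a prepattern argument consisting of a variable. A spine is prepattern ($S\ \mathsf{prepat}$) if it consists only of prepattern arguments $[x]$. A term is contractive ($M\ \mathsf{contra}$) if its head (under its $\lambda$'s) is a constructor or a variable, not a recursion constant. Simple types $\tau::=*\mid\tau_1\to\tau_2$, with erasure $(\Pi x{:}A_2.A_1)^o=A_2^o\to A_1^o$, $(\Pi x\,\hat{:}\,A_2.A_1)^o=*\to A_1^o$, $P^o=*$. The renaming $\{y/x\}M$ replaces variable $x$ by variable $y$ (also turning $[x]$ into $[y]$). Hereditary substitution $[N/x]^\tau$ is the partial operation: $[N/x]^\tau(\lambda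 y.M)=\lambda y.[N/x]^\tau M$ ($y\neq x$, $y$ not free in $N$); $[N/x]^\tau(x\cdot S)=([N/x]^\tau S)\rhd^\tau N$; $[N/x]^\tau(H\cdot S)=H\cdot[N/x]^\tau S$ for $H\ne x$; on spines componentwise, with $[N/x]^\tau([x];S)$ undefined and $[N/x]^\tau([z];S)=[z];[N/x]^\tau S$ for $z\neq x$; and $()\rhd^* R=R$, $(N;S)\rhd^{\tau_2\to\tau_1}(\lambda x.M)=S\rhd^{\tau_1}([N/x]^{\tau_2}M)$, $([y];S)\rhd^{*\to\tau_1}(\lambda x.M)=S\rhd^{\tau_1}(\{y/x\}M)$, undefined otherwise. Equality judgment. $\Theta$ is a list of distinct variables; $\Delta$ is a list of assumptions $\Theta'\vdash H\cdot S_1\doteq H'\cdot S_2$. A renaming $\sigma$ from $\Theta'$ to $\Theta$ (written $\Theta\vdash\sigma:\Theta'$) maps variables of $\Theta'$ to variables of $\Theta$. Rules for $\Delta;\Theta\vdash_\Sigma M=M'$: (1) if $\Theta'\vdash H\cdot S_1\doteq H'\cdot S_2$ is in $\Delta$ and $\Theta\vdash\sigma:\Theta'$, then $\Delta;\Theta\vdash_\Sigma \sigma(H\cdot S_1)=\sigma(H'\cdot S_2)$; (2) if $r:A=M\in\Sigma$, $S_1\ \mathsf{prepat}$, $M\ \mathsf{contra}$ and $\Delta,(\Theta\vdash r\cdot S_1\doteq H\cdot S_2);\Theta\vdash_\Sigma S_1\rhd^{A^o}M=H\cdot S_2$, then $\Delta;\Theta\vdash_\Sigma r\cdot S_1=H\cdot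 S_2$; (3) if $r:A=M\in\Sigma$, $S_2\ \mathsf{prepat}$, $M\ \mathsf{contra}$, $H$ is not a recursion constant, and $\Delta,(\Theta\vdash H\cdot S_1\doteq r\cdot S_2);\Theta\vdash_\Sigma H\cdot S_1=S_2\rhd^{A^o}M$, then $\Delta;\Theta\vdash_\Sigma H\cdot S_1=r\cdot S_2$; (4) $c\cdot S=c\cdot S'$ from $S=S'$; (5) $y\cdot S=y\cdot S'$ from $S=S'$; (6) $\Delta;\Theta\vdash_\Sigma\lambda x.M=\lambda x.M'$ from $\Delta;\Theta,x\vdash_\Sigma M=M'$. Spine equality $\Delta;\Theta\vdash_\Sigma S=S'$: $()=()$; $M;S=M';S'$ from $M=M'$ and $S=S'$; $[x];S=[x];S'$ from $S=S'$. *)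

theory Defs
  imports Main "HOL-Library.Nat_Bijection"
begin

section \<open>Syntax\<close>

text \<open>
  Expressions are taken up to renaming of bound variables, in locally nameless style: a bound
  variable is a de Bruijn index, a free variable is a name.  The classes of expressions modulo
  \<open>\<alpha>\<close>-equivalence are the locally closed expressions (\<open>lc_tm 0\<close>, \<open>lc_ty 0\<close>, \<open>lc_kind 0\<close>).
\<close>

type_synonym name = nat

datatype var = Free name | Bound nat

datatype head = Var var | Con name | Rec name

text \<open>\<open>SArg M S\<close> is \<open>M; S\<close>, and \<open>SPre x S\<close> is \<open>[x]; S\<close> (a prepattern argument).\<close>

datatype tm = Neu head spine | Lam tm
  and spine = SNil | SArg tm spine | SPre var spine

text \<open>\<open>PPi\<close> and \<open>KPPi\<close> are the prepattern \<open>\<Pi>\<close>'s; the second argument is the scope of the binder.\<close>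

datatype ty = Atom name spine | Pi ty ty | PPi ty ty

datatype kind = Type | Cotype | KPi ty kind | KPPi ty kind

datatype decl = FamDecl name kind | ConDecl name ty | RecDecl name ty tm

type_synonym sig = "decl list"

primrec lc_var :: "nat \<Rightarrow> var \<Rightarrow> bool" where
  "lc_var k (Free x) = True"
| "lc_var k (Bound i) = (i < k)"

primrec lc_head :: "nat \<Rightarrow> head \<Rightarrow> bool" where
  "lc_head k (Var v) = lc_var k v"
| "lc_head k (Con c) = True"
| "lc_head k (Rec r) = True"

primrec lc_tm :: "nat \<Rightarrow> tm \<Rightarrow> bool" and lc_sp :: "nat \<Rightarrow> spine \<Rightarrow> bool" where
  "lc_tm k (Neu H S) = (lc_head k H \<and> lc_sp k S)"
| "lc_tm k (Lam M) = lc_tm (Suc k) M"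
| "lc_sp k SNil = True"
| "lc_sp k (SArg M S) = (lc_tm k M \<and> lc_sp k S)"
| "lc_sp k (SPre v S) = (lc_var k v \<and> lc_sp k S)"

primrec lc_ty :: "nat \<Rightarrow> ty \<Rightarrow> bool" where
  "lc_ty k (Atom a S) = lc_sp k S"
| "lc_ty k (Pi A B) = (lc_ty k A \<and> lc_ty (Suc k) B)"
| "lc_ty k (PPi A B) = (lc_ty k A \<and> lc_ty (Suc k) B)"

primrec lc_kind :: "nat \<Rightarrow> kind \<Rightarrow> bool" where
  "lc_kind k Type = True"
| "lc_kind k Cotype = True"
| "lc_kind k (KPi A K) = (lc_ty k A \<and> lc_kind (Suc k) K)"
| "lc_kind k (KPPi A K) = (lc_ty k A \<and> lc_kind (Suc k) K)"

primrec fv_var :: "var \<Rightarrow> name set" where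
  "fv_var (Free x) = {x}"
| "fv_var (Bound i) = {}"

primrec fv_head :: "head \<Rightarrow> name set" where
  "fv_head (Var v) = fv_var v"
| "fv_head (Con c) = {}"
| "fv_head (Rec r) = {}"

primrec fv_tm :: "tm \<Rightarrow> name set" and fv_sp :: "spine \<Rightarrow> name set" where
  "fv_tm (Neu H S) = fv_head H \<union> fv_sp S"
| "fv_tm (Lam M) = fv_tm M"
| "fv_sp SNil = {}"
| "fv_sp (SArg M S) = fv_tm M \<union> fv_sp S"
| "fv_sp (SPre v S) = fv_var v \<union> fv_sp S"

primrec recs_head :: "head \<Rightarrow> name set" where
  "recs_head (Var v) = {}"
| "recs_head (Con c) = {}"
| "recs_head (Rec r) = {r}"

primrec recs_tm :: "tm \<Rightarrow> name set" and recs_sp :: "spine \<Rightarrow> name set" where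
  "recs_tm (Neu H S) = recs_head H \<union> recs_sp S"
| "recs_tm (Lam M) = recs_tm M"
| "recs_sp SNil = {}"
| "recs_sp (SArg M S) = recs_tm M \<union> recs_sp S"
| "recs_sp (SPre v S) = recs_sp S"

definition rational :: "sig \<Rightarrow> tm \<Rightarrow> bool" where
  "rational \<Sigma> M \<longleftrightarrow> lc_tm 0 M \<and> recs_tm M \<subseteq> {r. \<exists>A N. RecDecl r A N \<in> set \<Sigma>}"

primrec decl_ok :: "sig \<Rightarrow> decl \<Rightarrow> bool" where
  "decl_ok \<Sigma> (FamDecl a K) = lc_kind 0 K"
| "decl_ok \<Sigma> (ConDecl c A) = lc_ty 0 A"
| "decl_ok \<Sigma> (RecDecl r A M) = (lc_ty 0 A \<and> rational \<Sigma> M)"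

definition signature :: "sig \<Rightarrow> bool" where
  "signature \<Sigma> \<longleftrightarrow> (\<forall>d \<in> set \<Sigma>. decl_ok \<Sigma> d)"

definition fv_sig :: "sig \<Rightarrow> name set" where
  "fv_sig \<Sigma> = \<Union> {fv_tm M | r A M. RecDecl r A M \<in> set \<Sigma>}"

primrec prepat :: "spine \<Rightarrow> bool" where
  "prepat SNil = True"
| "prepat (SArg M S) = False"
| "prepat (SPre v S) = prepat S"

primrec contra :: "tm \<Rightarrow> bool" where
  "contra (Neu H S) = (\<forall>r. H \<noteq> Rec r)"
| "contra (Lam M) = contra M"


section \<open>Renaming and hereditary substitution\<close>

primrec ren_var :: "(name \<Rightarrow> name) \<Rightarrow> var \<Rightarrow> var" where
  "ren_var \<sigma> (Free x) = Free (\<sigma> x)"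
| "ren_var \<sigma> (Bound i) = Bound i"

primrec ren_head :: "(name \<Rightarrow> name) \<Rightarrow> head \<Rightarrow> head" where
  "ren_head \<sigma> (Var v) = Var (ren_var \<sigma> v)"
| "ren_head \<sigma> (Con c) = Con c"
| "ren_head \<sigma> (Rec r) = Rec r"

primrec ren_tm :: "(name \<Rightarrow> name) \<Rightarrow> tm \<Rightarrow> tm"
  and ren_sp :: "(name \<Rightarrow> name) \<Rightarrow> spine \<Rightarrow> spine" where
  "ren_tm \<sigma> (Neu H S) = Neu (ren_head \<sigma> H) (ren_sp \<sigma> S)"
| "ren_tm \<sigma> (Lam M) = Lam (ren_tm \<sigma> M)"
| "ren_sp \<sigma> SNil = SNil"
| "ren_sp \<sigma> (SArg M S) = SArg (ren_tm \<sigma> M) (ren_sp \<sigma> S)"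
| "ren_sp \<sigma> (SPre v S) = SPre (ren_var \<sigma> v) (ren_sp \<sigma> S)"

text \<open>
  \<open>opn_tm k x M\<close> replaces the index \<open>k\<close> by the name \<open>x\<close>, and \<open>cls_tm k x M\<close> replaces the name \<open>x\<close>
  by the index \<open>k\<close>.  For \<open>x\<close> not free in \<open>M\<close>, the abstraction \<open>Lam M\<close> is \<open>\<lambda>x. opn_tm 0 x M\<close>;
  \<open>\<lambda>x. M\<close> is \<open>Lam (cls_tm 0 x M)\<close>.
\<close>

primrec opn_var :: "nat \<Rightarrow> name \<Rightarrow> var \<Rightarrow> var" where
  "opn_var k x (Free y) = Free y"
| "opn_var k x (Bound i) = (if i = k then Free x else Bound i)"

primrec opn_head :: "nat \<Rightarrow> name \<Rightarrow> head \<Rightarrow> head" where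
  "opn_head k x (Var v) = Var (opn_var k x v)"
| "opn_head k x (Con c) = Con c"
| "opn_head k x (Rec r) = Rec r"

primrec opn_tm :: "nat \<Rightarrow> name \<Rightarrow> tm \<Rightarrow> tm"
  and opn_sp :: "nat \<Rightarrow> name \<Rightarrow> spine \<Rightarrow> spine" where
  "opn_tm k x (Neu H S) = Neu (opn_head k x H) (opn_sp k x S)"
| "opn_tm k x (Lam M) = Lam (opn_tm (Suc k) x M)"
| "opn_sp k x SNil = SNil"
| "opn_sp k x (SArg M S) = SArg (opn_tm k x M) (opn_sp k x S)"
| "opn_sp k x (SPre v S) = SPre (opn_var k x v) (opn_sp k x S)"

primrec cls_var :: "nat \<Rightarrow> name \<Rightarrow> var \<Rightarrow> var" where
  "cls_var k x (Free y) = (if y = x then Bound k else Free y)"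
| "cls_var k x (Bound i) = Bound i"

primrec cls_head :: "nat \<Rightarrow> name \<Rightarrow> head \<Rightarrow> head" where
  "cls_head k x (Var v) = Var (cls_var k x v)"
| "cls_head k x (Con c) = Con c"
| "cls_head k x (Rec r) = Rec r"

primrec cls_tm :: "nat \<Rightarrow> name \<Rightarrow> tm \<Rightarrow> tm"
  and cls_sp :: "nat \<Rightarrow> name \<Rightarrow> spine \<Rightarrow> spine" where
  "cls_tm k x (Neu H S) = Neu (cls_head k x H) (cls_sp k x S)"
| "cls_tm k x (Lam M) = Lam (cls_tm (Suc k) x M)"
| "cls_sp k x SNil = SNil"
| "cls_sp k x (SArg M S) = SArg (cls_tm k x M) (cls_sp k x S)"
| "cls_sp k x (SPre v S) = SPre (cls_var k x v) (cls_sp k x S)"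

datatype sty = Base | Arr sty sty

primrec erase :: "ty \<Rightarrow> sty" where
  "erase (Atom a S) = Base"
| "erase (Pi A B) = Arr (erase A) (erase B)"
| "erase (PPi A B) = Arr Base (erase B)"

text \<open>
  The partial operations are given by their graphs: \<open>hsubst_tm N x \<tau> M M'\<close> means that
  \<open>[N/x]\<^sup>\<tau> M\<close> is defined and equal to \<open>M'\<close>, similarly for \<open>hsubst_sp\<close> on spines, and
  \<open>rhd S \<tau> M M'\<close> means that \<open>S \<rhd>\<^sup>\<tau> M\<close> is defined and equal to \<open>M'\<close>.
\<close>

inductive hsubst_tm :: "tm \<Rightarrow> name \<Rightarrow> sty \<Rightarrow> tm \<Rightarrow> tm \<Rightarrow> bool"
  and hsubst_sp :: "tm \<Rightarrow> name \<Rightarrow> sty \<Rightarrow> spine \<Rightarrow> spine \<Rightarrow> bool"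
  and rhd :: "spine \<Rightarrow> sty \<Rightarrow> tm \<Rightarrow> tm \<Rightarrow> bool" where
  hs_lam: "\<lbrakk>y \<noteq> x; y \<notin> fv_tm N; y \<notin> fv_tm M; hsubst_tm N x \<tau> (opn_tm 0 y M) M'\<rbrakk>
    \<Longrightarrow> hsubst_tm N x \<tau> (Lam M) (Lam (cls_tm 0 y M'))"
| hs_var: "\<lbrakk>hsubst_sp N x \<tau> S S'; rhd S' \<tau> N M'\<rbrakk>
    \<Longrightarrow> hsubst_tm N x \<tau> (Neu (Var (Free x)) S) M'"
| hs_head: "\<lbrakk>H \<noteq> Var (Free x); hsubst_sp N x \<tau> S S'\<rbrakk>
    \<Longrightarrow> hsubst_tm N x \<tau> (Neu H S) (Neu H S')"
| hs_nil: "hsubst_sp N x \<tau> SNil SNil"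
| hs_arg: "\<lbrakk>hsubst_tm N x \<tau> M M'; hsubst_sp N x \<tau> S S'\<rbrakk>
    \<Longrightarrow> hsubst_sp N x \<tau> (SArg M S) (SArg M' S')"
| hs_pre: "\<lbrakk>v \<noteq> Free x; hsubst_sp N x \<tau> S S'\<rbrakk>
    \<Longrightarrow> hsubst_sp N x \<tau> (SPre v S) (SPre v S')"
| rhd_nil: "rhd SNil Base (Neu H S) (Neu H S)"
| rhd_arg: "\<lbrakk>x \<notin> fv_tm M; x \<notin> fv_tm N; hsubst_tm N x \<tau>2 (opn_tm 0 x M) M1; rhd S \<tau>1 M1 M'\<rbrakk>
    \<Longrightarrow> rhd (SArg N S) (Arr \<tau>2 \<tau>1) (Lam M) M'"
| rhd_pre: "\<lbrakk>x \<notin> fv_tm M; rhd S \<tau>1 (ren_tm (id(x := y)) (opn_tm 0 x M)) M'\<rbrakk>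
    \<Longrightarrow> rhd (SPre (Free y) S) (Arr Base \<tau>1) (Lam M) M'"


section \<open>The equality judgment\<close>

text \<open>\<open>Assm \<Theta> H S H' S'\<close> is the assumption \<open>\<Theta> \<turnstile> H \<cdot> S \<doteq> H' \<cdot> S'\<close>.\<close>

datatype assm = Assm "name list" head spine head spine

primrec assm_ok :: "assm \<Rightarrow> bool" where
  "assm_ok (Assm \<Theta> H S H' S') = (distinct \<Theta> \<and> lc_tm 0 (Neu H S) \<and> lc_tm 0 (Neu H' S'))"

primrec names_assm :: "assm \<Rightarrow> name set" where
  "names_assm (Assm \<Theta> H S H' S') = set \<Theta> \<union> fv_tm (Neu H S) \<union> fv_tm (Neu H' S')"

text \<open>\<open>renaming \<Theta> \<sigma> \<Theta>'\<close> is \<open>\<Theta> \<turnstile> \<sigma> : \<Theta>'\<close>; variables outside \<open>\<Theta>'\<close> are left alone.\<close>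

definition renaming :: "name list \<Rightarrow> (name \<Rightarrow> name) \<Rightarrow> name list \<Rightarrow> bool" where
  "renaming \<Theta> \<sigma> \<Theta>' \<longleftrightarrow> (\<forall>x \<in> set \<Theta>'. \<sigma> x \<in> set \<Theta>) \<and> (\<forall>x. x \<notin> set \<Theta>' \<longrightarrow> \<sigma> x = x)"

text \<open>
  In \<open>eq_lam\<close> the name of the bound variable is fresh for the whole conclusion (including \<open>\<Sigma>\<close>),
  as usual when terms are identified up to renaming of bound variables.
\<close>

inductive eq_tm :: "sig \<Rightarrow> assm list \<Rightarrow> name list \<Rightarrow> tm \<Rightarrow> tm \<Rightarrow> bool"
  and eq_sp :: "sig \<Rightarrow> assm list \<Rightarrow> name list \<Rightarrow> spine \<Rightarrow> spine \<Rightarrow> bool"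
  for \<Sigma> :: sig where
  eq_assm: "\<lbrakk>Assm \<Theta>' H S1 H' S2 \<in> set \<Delta>; renaming \<Theta> \<sigma> \<Theta>'\<rbrakk>
    \<Longrightarrow> eq_tm \<Sigma> \<Delta> \<Theta> (ren_tm \<sigma> (Neu H S1)) (ren_tm \<sigma> (Neu H' S2))"
| eq_unfold_left: "\<lbrakk>RecDecl r A M \<in> set \<Sigma>; prepat S1; contra M; rhd S1 (erase A) M N;
      eq_tm \<Sigma> (\<Delta> @ [Assm \<Theta> (Rec r) S1 H S2]) \<Theta> N (Neu H S2)\<rbrakk>
    \<Longrightarrow> eq_tm \<Sigma> \<Delta> \<Theta> (Neu (Rec r) S1) (Neu H S2)"
| eq_unfold_right: "\<lbrakk>RecDecl r A M \<in> set \<Sigma>; prepat S2; contra M; \<forall>r'. H \<noteq> Rec r';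
      rhd S2 (erase A) M N; eq_tm \<Sigma> (\<Delta> @ [Assm \<Theta> H S1 (Rec r) S2]) \<Theta> (Neu H S1) N\<rbrakk>
    \<Longrightarrow> eq_tm \<Sigma> \<Delta> \<Theta> (Neu H S1) (Neu (Rec r) S2)"
| eq_con: "eq_sp \<Sigma> \<Delta> \<Theta> S S' \<Longrightarrow> eq_tm \<Sigma> \<Delta> \<Theta> (Neu (Con c) S) (Neu (Con c) S')"
| eq_var: "eq_sp \<Sigma> \<Delta> \<Theta> S S'
    \<Longrightarrow> eq_tm \<Sigma> \<Delta> \<Theta> (Neu (Var (Free y)) S) (Neu (Var (Free y)) S')"
| eq_lam: "\<lbrakk>x \<notin> set \<Theta>; x \<notin> fv_tm M; x \<notin> fv_tm M'; x \<notin> (\<Union>\<delta> \<in> set \<Delta>. names_assm \<delta>);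
      x \<notin> fv_sig \<Sigma>; eq_tm \<Sigma> \<Delta> (\<Theta> @ [x]) (opn_tm 0 x M) (opn_tm 0 x M')\<rbrakk>
    \<Longrightarrow> eq_tm \<Sigma> \<Delta> \<Theta> (Lam M) (Lam M')"
| eq_nil: "eq_sp \<Sigma> \<Delta> \<Theta> SNil SNil"
| eq_arg: "\<lbrakk>eq_tm \<Sigma> \<Delta> \<Theta> M M'; eq_sp \<Sigma> \<Delta> \<Theta> S S'\<rbrakk>
    \<Longrightarrow> eq_sp \<Sigma> \<Delta> \<Theta> (SArg M S) (SArg M' S')"
| eq_pre: "eq_sp \<Sigma> \<Delta> \<Theta> S S'
    \<Longrightarrow> eq_sp \<Sigma> \<Delta> \<Theta> (SPre (Free x) S) (SPre (Free x) S')"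


section \<open>Decidability\<close>

text \<open>
  The (total) recursive functions: \<open>recursive n f\<close> says that \<open>f\<close>, restricted to argument lists of
  length \<open>n\<close>, belongs to the least class that contains zero, successor and the projections and is
  closed under composition, primitive recursion and minimization of regular functions.
\<close>

inductive recursive :: "nat \<Rightarrow> (nat list \<Rightarrow> nat) \<Rightarrow> bool" where
  rec_zero: "recursive n (\<lambda>xs. 0)"
| rec_succ: "recursive 1 (\<lambda>xs. Suc (hd xs))"
| rec_proj: "i < n \<Longrightarrow> recursive n (\<lambda>xs. xs ! i)"
| rec_comp: "\<lbrakk>recursive (length gs) f; \<forall>g \<in> set gs. recursive n g\<rbrakk>
    \<Longrightarrow> recursive n (\<lambda>xs. f (map (\<lambda>g. g xs) gs))"
| rec_prim: "\<lbrakk>recursive n f; recursive (n + 2) g\<rbrakk>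
    \<Longrightarrow> recursive (Suc n)
          (\<lambda>xs. rec_nat (f (tl xs)) (\<lambda>k v. g (k # v # tl xs)) (hd xs))"
| rec_mu: "\<lbrakk>recursive (Suc n) f; \<forall>xs. length xs = n \<longrightarrow> (\<exists>k. f (k # xs) = 0)\<rbrakk>
    \<Longrightarrow> recursive n (\<lambda>xs. LEAST k. f (k # xs) = 0)"
| rec_ext: "\<lbrakk>recursive n f; \<forall>xs. length xs = n \<longrightarrow> g xs = f xs\<rbrakk> \<Longrightarrow> recursive n g"

text \<open>
  The problem whether \<open>P x\<close> holds, for instances \<open>x \<in> D\<close> presented by their Goedel number \<open>enc x\<close>,
  is decidable.
\<close>

definition decidable_on :: "('a \<Rightarrow> nat) \<Rightarrow> 'a set \<Rightarrow> ('a \<Rightarrow> bool) \<Rightarrow> bool" where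
  "decidable_on enc D P \<longleftrightarrow>
     (\<exists>f. recursive 1 f \<and> (\<forall>x \<in> D. f [enc x] = (if P x then 1 else 0)))"

primrec enc_var :: "var \<Rightarrow> nat" where
  "enc_var (Free x) = list_encode [0, x]"
| "enc_var (Bound i) = list_encode [1, i]"

primrec enc_head :: "head \<Rightarrow> nat" where
  "enc_head (Var v) = list_encode [0, enc_var v]"
| "enc_head (Con c) = list_encode [1, c]"
| "enc_head (Rec r) = list_encode [2, r]"

primrec enc_tm :: "tm \<Rightarrow> nat" and enc_sp :: "spine \<Rightarrow> nat" where
  "enc_tm (Neu H S) = list_encode [0, enc_head H, enc_sp S]"
| "enc_tm (Lam M) = list_encode [1, enc_tm M]"
| "enc_sp SNil = list_encode [0]"
| "enc_sp (SArg M S) = list_encode [1, enc_tm M, enc_sp S]"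
| "enc_sp (SPre v S) = list_encode [2, enc_var v, enc_sp S]"

primrec enc_assm :: "assm \<Rightarrow> nat" where
  "enc_assm (Assm \<Theta> H S H' S') =
     list_encode [list_encode \<Theta>, enc_head H, enc_sp S, enc_head H', enc_sp S']"

fun enc_instance :: "assm list \<times> name list \<times> tm \<times> tm \<Rightarrow> nat" where
  "enc_instance (\<Delta>, \<Theta>, M, M') =
     list_encode [list_encode (map enc_assm \<Delta>), list_encode \<Theta>, enc_tm M, enc_tm M']"

lemma enc_var_inj: "enc_var v = enc_var w \<longleftrightarrow> v = w"
  by (cases v; cases w) (simp_all del: list_encode.simps add: list_encode_eq)

lemma enc_head_inj: "enc_head H = enc_head H' \<longleftrightarrow> H = H'"
  by (cases H; cases H') (simp_all del: list_encode.simps add: list_encode_eq enc_var_inj)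

lemma enc_tm_inj: "enc_tm M = enc_tm M' \<longleftrightarrow> M = M'"
  and enc_sp_inj: "enc_sp S = enc_sp S' \<longleftrightarrow> S = S'"
proof (induction M and S arbitrary: M' and S')
  case (Neu H S) then show ?case
    by (cases M') (simp_all del: list_encode.simps add: list_encode_eq enc_head_inj)
next
  case (Lam M) then show ?case
    by (cases M') (simp_all del: list_encode.simps add: list_encode_eq)
next
  case SNil show ?case
    by (cases S') (simp_all del: list_encode.simps add: list_encode_eq)
next
  case (SArg M S) then show ?case
    by (cases S') (simp_all del: list_encode.simps add: list_encode_eq)
next
  case (SPre v S) then show ?case
    by (cases S') (simp_all del: list_encode.simps add: list_encode_eq enc_var_inj)
qed

lemma enc_assm_inj: "enc_assm a = enc_assm b \<longleftrightarrow> a = b"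
  by (cases a; cases b)
    (simp del: list_encode.simps add: list_encode_eq enc_head_inj enc_sp_inj)

lemma inj_enc_instance: "inj enc_instance"
proof (rule injI)
  fix p q assume eq: "enc_instance p = enc_instance q"
  obtain D T M N D' T' M' N' where pq: "p = (D, T, M, N)" "q = (D', T', M', N')"
    by (cases p; cases q) auto
  have "inj enc_assm" by (simp add: inj_def enc_assm_inj)
  with eq show "p = q"
    by (simp del: list_encode.simps add: pq list_encode_eq enc_tm_inj inj_map_eq_map)
qed

end

theory Submission
  imports Defs
begin

text \<open>
  Unfolding only happens on prepattern spines, so it substitutes variables for variables and never
  leaves the finitely many shapes (terms with all variables blanked out) of subterms of the goal and
  of \<open>\<Sigma>\<close>.  Call a name old if it occurs in the initial goal or in \<open>\<Sigma>\<close>; all other names were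
  introduced by \<open>eq_lam\<close> and are listed in \<open>\<Theta>\<close>.  If two goals on a branch of the search have the same
  shapes, the same old variables at the same places and the same equalities among their variables,
  then a renaming of new names maps the first one to the second one, and the assumption rule closes
  the second one.  Hence a search that unfolds only when the assumption rule does not apply
  terminates: every unfolding uses up one of finitely many classes of goals, and the other steps make
  the left-hand term smaller.  Equivariance of the judgment allows the search to fix the fresh name
  in \<open>eq_lam\<close>.

  To see that the search is recursive, it is written as a program in a small language of first-order
  recursion on S-expressions.  The value of a program is found by minimization over memo tables in
  which every entry is justified by the later entries.
\<close>

text \<open>The class \<open>recursive\<close> admits minimization only of regular functions, so the
  program needs a value on every number and not just on codes of instances. Hence
  \<open>main_body\<close> first turns its input into the code of some instance, leaving genuine
  codes unchanged, and termination is shown for arbitrary terms, dangling indices included. Apart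
  from the assumption rule, the heads of a goal determine which rule applies. Trying that rule first
  loses nothing, since a success settles the goal, and its failure is exactly what makes an
  unfolding lower the number of uncovered classes. Inversion turns every step of the search into an
  equivalence with \<open>eq_tm\<close>, so one induction gives termination, soundness and
  completeness at once. Shapes are confined by a bound \<open>b\<close> on their Goedel numbers.
  Blanking out the variables is essential here: the names chosen for \<open>eq_lam\<close> are huge,
  and they would raise the codes of the terms without limit.\<close>

declare list_encode.simps [simp del]

section \<open>Recursive functions\<close>

definition rec_pred :: "nat \<Rightarrow> (nat list \<Rightarrow> bool) \<Rightarrow> bool" where
  "rec_pred n P \<longleftrightarrow> recursive n (\<lambda>xs. of_bool (P xs))"

lemma recursive_cong:
  assumes "recursive n f" and "\<And>xs. length xs = n \<Longrightarrow> g xs = f xs"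
  shows "recursive n g"
  using assms rec_ext by blast

lemma recursive_Suc:
  assumes "recursive n f"
  shows "recursive n (\<lambda>xs. Suc (f xs))"
  using rec_comp[of "[f]" "\<lambda>xs. Suc (hd xs)" n] rec_succ assms by simp

lemma recursive_const: "recursive n (\<lambda>xs. c)"
  by (induction c) (auto intro: rec_zero recursive_Suc)

text \<open>Composition takes an explicit list of functions; the \<open>n\<close> projections
  reproduce \<open>xs\<close> behind the new first argument.\<close>

lemma recursive_Cons_comp:
  assumes f: "recursive (Suc n) f" and h: "recursive n h"
  shows "recursive n (\<lambda>xs. f (h xs # xs))"
proof -
  let ?gs = "h # map (\<lambda>i xs. xs ! i) [0..<n]"
  have "recursive n (\<lambda>xs. f (map (\<lambda>g. g xs) ?gs))"
    using f h by (intro rec_comp) (auto intro: rec_proj)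
  moreover have "f (h xs # xs) = f (map (\<lambda>g. g xs) ?gs)" if "length xs = n" for xs
    using map_nth[of xs] that by (simp add: comp_def)
  ultimately show ?thesis by (rule recursive_cong)
qed

lemma recursive_rec_nat:
  assumes "recursive n f" "recursive (n + 2) g" "recursive n h"
  shows "recursive n (\<lambda>xs. rec_nat (f xs) (\<lambda>k v. g (k # v # xs)) (h xs))"
  using recursive_Cons_comp[OF rec_prim[OF assms(1,2)] assms(3)] by simp

lemma recursive_tl:
  assumes "recursive n f"
  shows "recursive (Suc n) (\<lambda>xs. f (tl xs))"
proof -
  let ?gs = "map (\<lambda>i xs. xs ! Suc i) [0..<n]"
  have "recursive (Suc n) (\<lambda>xs. f (map (\<lambda>g. g xs) ?gs))"
    using assms by (intro rec_comp) (auto intro: rec_proj)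
  moreover have "f (tl xs) = f (map (\<lambda>g. g xs) ?gs)" if "length xs = Suc n" for xs
  proof -
    have "tl xs = map (\<lambda>i. xs ! Suc i) [0..<n]"
      using that by (intro nth_equalityI) (auto simp: nth_tl)
    then show ?thesis by (simp add: comp_def)
  qed
  ultimately show ?thesis by (rule recursive_cong)
qed

section \<open>Arithmetic, logical connectives and bounded search\<close>

lemma recursive_add:
  assumes "recursive n f" "recursive n g"
  shows "recursive n (\<lambda>xs. f xs + g xs)"
proof -
  have "recursive n (\<lambda>xs. rec_nat (f xs) (\<lambda>k v. Suc ((k # v # xs) ! 1)) (g xs))"
    by (rule recursive_rec_nat[where g = "\<lambda>ys. Suc (ys ! 1)"])
      (intro assms recursive_Suc rec_proj; simp)+
  moreover have "rec_nat a (\<lambda>k v. Suc v) b = a + b" for a b :: nat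
    by (induction b) auto
  ultimately show ?thesis by simp
qed

lemma recursive_pred:
  assumes "recursive n f"
  shows "recursive n (\<lambda>xs. f xs - 1)"
proof -
  have "recursive n (\<lambda>xs. rec_nat 0 (\<lambda>k v. (k # v # xs) ! 0) (f xs))"
    by (rule recursive_rec_nat[where g = "\<lambda>ys. ys ! 0"]) (intro assms rec_zero rec_proj; simp)+
  moreover have "rec_nat 0 (\<lambda>k v. k) b = b - 1" for b :: nat
    by (cases b) auto
  ultimately show ?thesis by simp
qed

lemma recursive_diff:
  assumes "recursive n f" "recursive n g"
  shows "recursive n (\<lambda>xs. f xs - g xs)"
proof -
  have "recursive n (\<lambda>xs. rec_nat (f xs) (\<lambda>k v. (k # v # xs) ! 1 - 1) (g xs))"
    by (rule recursive_rec_nat[where g = "\<lambda>ys. ys ! 1 - 1"])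
      (intro assms recursive_pred rec_proj; simp)+
  moreover have "rec_nat a (\<lambda>k v. v - 1) b = a - b" for a b :: nat
    by (induction b) auto
  ultimately show ?thesis by simp
qed

lemma recursive_triangle:
  assumes "recursive n f"
  shows "recursive n (\<lambda>xs. triangle (f xs))"
proof -
  have "recursive n (\<lambda>xs. rec_nat 0 (\<lambda>k v. (k # v # xs) ! 1 + Suc ((k # v # xs) ! 0)) (f xs))"
    by (rule recursive_rec_nat[where g = "\<lambda>ys. ys ! 1 + Suc (ys ! 0)"])
      (intro assms recursive_add recursive_Suc rec_proj rec_zero; simp)+
  moreover have "rec_nat 0 (\<lambda>k v. v + Suc k) b = triangle b" for b :: nat
    by (induction b) auto
  ultimately show ?thesis by simp
qed

text \<open>Case distinction is primitive recursion on the truth value: zero rounds give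
  \<open>g\<close>, one round gives \<open>f\<close>.\<close>

lemma recursive_If:
  assumes "rec_pred n P" "recursive n f" "recursive n g"
  shows "recursive n (\<lambda>xs. if P xs then f xs else g xs)"
proof -
  have "recursive n (\<lambda>xs. rec_nat (g xs) (\<lambda>k v. f (tl (tl (k # v # xs)))) (of_bool (P xs)))"
    using assms recursive_tl[OF recursive_tl[OF assms(2)]] unfolding rec_pred_def
    by (intro recursive_rec_nat[where g = "\<lambda>ys. f (tl (tl ys))"]) simp_all
  then show ?thesis by (rule recursive_cong) simp
qed

lemma rec_pred_eq0:
  assumes "recursive n f"
  shows "rec_pred n (\<lambda>xs. f xs = 0)"
proof -
  have "recursive n (\<lambda>xs. 1 - f xs)"
    by (intro recursive_diff recursive_const assms)
  then show ?thesis unfolding rec_pred_def by (rule recursive_cong) simp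
qed

lemma rec_pred_le:
  assumes "recursive n f" "recursive n g"
  shows "rec_pred n (\<lambda>xs. f xs \<le> g xs)"
  using rec_pred_eq0[OF recursive_diff[OF assms]] by simp

lemma rec_pred_not:
  assumes "rec_pred n P"
  shows "rec_pred n (\<lambda>xs. \<not> P xs)"
  using rec_pred_eq0[OF assms[unfolded rec_pred_def]] by simp

lemma rec_pred_conj:
  assumes "rec_pred n P" "rec_pred n Q"
  shows "rec_pred n (\<lambda>xs. P xs \<and> Q xs)"
proof -
  have "recursive n (\<lambda>xs. if P xs then (if Q xs then 1 else 0) else (0::nat))"
    by (intro recursive_If assms recursive_const)
  then show ?thesis unfolding rec_pred_def by (rule recursive_cong) simp
qed

lemma rec_pred_disj:
  assumes "rec_pred n P" "rec_pred n Q"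
  shows "rec_pred n (\<lambda>xs. P xs \<or> Q xs)"
  using rec_pred_not[OF rec_pred_conj[OF rec_pred_not[OF assms(1)] rec_pred_not[OF assms(2)]]]
  by simp

lemma rec_pred_eq:
  assumes "recursive n f" "recursive n g"
  shows "rec_pred n (\<lambda>xs. f xs = g xs)"
  using rec_pred_conj[OF rec_pred_le[OF assms] rec_pred_le[OF assms(2,1)]]
  by (simp add: eq_iff)

text \<open>Minimization looks for a zero, so it is applied to the characteristic function of the
  negation; the second assumption is regularity.\<close>

lemma recursive_Least:
  assumes "rec_pred (Suc n) P" "\<And>xs. length xs = n \<Longrightarrow> \<exists>k. P (k # xs)"
  shows "recursive n (\<lambda>xs. LEAST k. P (k # xs))"
  using rec_mu[OF rec_pred_not[OF assms(1), unfolded rec_pred_def]] assms(2) by simp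

text \<open>The first counterexample is located by minimization. The alternative
  \<open>h (tl ys) \<le> ys ! 0\<close> stops the search at the bound, which makes it regular; the
  quantified statement is true iff the search gets that far.\<close>

lemma rec_pred_all_less:
  assumes P: "rec_pred (Suc n) P" and h: "recursive n h"
  shows "rec_pred n (\<lambda>xs. \<forall>k < h xs. P (k # xs))"
proof -
  let ?Q = "\<lambda>ys. h (tl ys) \<le> ys ! 0 \<or> \<not> P ys"
  have Q: "\<exists>k. ?Q (k # xs)" for xs by auto
  have "rec_pred (Suc n) ?Q"
    using rec_pred_disj[OF rec_pred_le[OF recursive_tl[OF h] rec_proj] rec_pred_not[OF P]] by simp
  then have "rec_pred n (\<lambda>xs. h xs \<le> (LEAST k. ?Q (k # xs)))"
    using Q by (intro rec_pred_le[OF h] recursive_Least[of n ?Q])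
  moreover have "h xs \<le> (LEAST k. ?Q (k # xs)) \<longleftrightarrow> (\<forall>k < h xs. P (k # xs))" for xs
  proof
    assume "h xs \<le> (LEAST k. ?Q (k # xs))"
    then have "\<not> ?Q (k # xs)" if "k < h xs" for k
      using not_less_Least[of k "\<lambda>k. ?Q (k # xs)"] that by linarith
    then show "\<forall>k < h xs. P (k # xs)" by simp
  next
    define L where "L = (LEAST k. ?Q (k # xs))"
    assume "\<forall>k < h xs. P (k # xs)"
    moreover have "?Q (L # xs)" unfolding L_def by (rule LeastI_ex[OF Q[of xs]])
    ultimately have "h xs \<le> L" by (cases "h xs \<le> L") auto
    then show "h xs \<le> (LEAST k. ?Q (k # xs))" unfolding L_def .
  qed
  ultimately show ?thesis by simp
qed


section \<open>Natural numbers as S-expressions\<close>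

text \<open>
  Since \<open>list_encode\<close> is a bijection, every number is either \<open>0\<close> (nil) or a cons cell.
\<close>

definition consc :: "nat \<Rightarrow> nat \<Rightarrow> nat" where "consc a b = Suc (prod_encode (a, b))"
definition hdc :: "nat \<Rightarrow> nat" where "hdc n = fst (prod_decode (n - 1))"
definition tlc :: "nat \<Rightarrow> nat" where "tlc n = snd (prod_decode (n - 1))"

lemma hdc_consc [simp]: "hdc (consc a b) = a"
  and tlc_consc [simp]: "tlc (consc a b) = b"
  and consc_neq_0 [simp]: "consc a b \<noteq> 0"
  by (simp_all add: hdc_def tlc_def consc_def)

lemma consc_hdc_tlc: "n \<noteq> 0 \<Longrightarrow> consc (hdc n) (tlc n) = n"
  by (simp add: hdc_def tlc_def consc_def)

lemma list_encode_Cons: "list_encode (x # xs) = consc x (list_encode xs)"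
  by (simp add: consc_def list_encode.simps)

lemma list_encode_Nil: "list_encode [] = 0"
  by (simp add: list_encode.simps)

lemma hdc_list_encode [simp]: "hdc (list_encode (x # xs)) = x"
  and tlc_list_encode [simp]: "tlc (list_encode (x # xs)) = list_encode xs"
  and consc_list_encode [simp]: "consc x (list_encode xs) = list_encode (x # xs)"
  by (simp_all add: list_encode_Cons)

lemma list_encode_eq_0 [simp]: "list_encode xs = 0 \<longleftrightarrow> xs = []"
  by (cases xs) (simp_all add: list_encode.simps)

lemma consc_greater: "a < consc a b" "b < consc a b"
  using le_prod_encode_1[of a b] le_prod_encode_2[of b a] by (simp_all add: consc_def)

lemma hdc_less: "n \<noteq> 0 \<Longrightarrow> hdc n < n" and tlc_less: "n \<noteq> 0 \<Longrightarrow> tlc n < n"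
  using consc_greater consc_hdc_tlc by metis+

text \<open>Truncated subtraction lets \<open>0\<close> decode like the pair of two zeros. Nil is
  thus its own head and tail, and field access is harmless on any number.\<close>

lemma hdc_0 [simp]: "hdc 0 = 0" and tlc_0 [simp]: "tlc 0 = 0"
  by (simp_all add: hdc_def tlc_def prod_decode_def prod_decode_aux.simps)

text \<open>Used in two ways: subterms have smaller codes, and a code exceeds every name occurring
  in what it encodes, which supplies fresh names.\<close>

lemma list_encode_greater: "x \<in> set xs \<Longrightarrow> x < list_encode xs"
proof (induction xs)
  case (Cons y ys)
  then show ?case
    using consc_greater(1)[of y "list_encode ys"] consc_greater(2)[of "list_encode ys" y]
    by (auto simp: list_encode_Cons simp del: consc_list_encode)
qed simp

lemma length_le_list_encode: "length xs \<le> list_encode xs"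
proof (induction xs)
  case (Cons y ys)
  then show ?case
    using consc_greater(2)[of "list_encode ys" y] by (simp del: consc_list_encode add: list_encode_Cons)
qed simp

text \<open>Cantor pairing runs through the diagonals: the code of \<open>(a, b)\<close> is
  \<open>triangle (a + b) + a\<close>. The search finds the diagonal \<open>a + b\<close>, and the
  offset on it is \<open>a\<close>.\<close>

lemma prod_decode_Least:
  fixes n :: nat
  defines "s \<equiv> LEAST s. n < triangle (Suc s)"
  shows "prod_decode n = (n - triangle s, s - (n - triangle s))"
proof -
  obtain a b where ab: "prod_decode n = (a, b)" by fastforce
  then have n: "n = triangle (a + b) + a"
    using prod_decode_inverse[of n] by (simp add: prod_encode_def)
  have mono: "triangle i \<le> triangle j" if "i \<le> j" for i j
    using that by (induction rule: dec_induct) auto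
  have "s = a + b"
    unfolding s_def
  proof (rule Least_equality)
    show "n < triangle (Suc (a + b))" using n by simp
    show "a + b \<le> y" if "n < triangle (Suc y)" for y
    proof (rule ccontr)
      assume "\<not> a + b \<le> y"
      then have "triangle (Suc y) \<le> triangle (a + b)" by (intro mono) simp
      then show False using n that by linarith
    qed
  qed
  then show ?thesis using ab n by simp
qed

lemma recursive_prod_decode:
  assumes f: "recursive n f"
  shows "recursive n (\<lambda>xs. fst (prod_decode (f xs)))"
    and "recursive n (\<lambda>xs. snd (prod_decode (f xs)))"
proof -
  let ?s = "\<lambda>xs. LEAST s. f (tl (s # xs)) < triangle (Suc ((s # xs) ! 0))"
  have "rec_pred (Suc n) (\<lambda>ys. \<not> triangle (Suc (ys ! 0)) \<le> f (tl ys))"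
    by (rule rec_pred_not[OF rec_pred_le[OF recursive_triangle[OF recursive_Suc[OF rec_proj]]
            recursive_tl[OF f]]]) simp
  then have "rec_pred (Suc n) (\<lambda>ys. f (tl ys) < triangle (Suc (ys ! 0)))"
    by (simp add: not_le)
  moreover have "f (tl (f xs # xs)) < triangle (Suc ((f xs # xs) ! 0))" for xs by simp
  ultimately have s: "recursive n ?s" by (intro recursive_Least) blast+
  have "recursive n (\<lambda>xs. f xs - triangle (?s xs))"
    by (intro recursive_diff recursive_triangle s f)
  then show "recursive n (\<lambda>xs. fst (prod_decode (f xs)))"
    by (rule recursive_cong) (simp add: prod_decode_Least del: triangle_Suc)
  have "recursive n (\<lambda>xs. ?s xs - (f xs - triangle (?s xs)))"
    by (intro recursive_diff recursive_triangle s f)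
  then show "recursive n (\<lambda>xs. snd (prod_decode (f xs)))"
    by (rule recursive_cong) (simp add: prod_decode_Least del: triangle_Suc)
qed

lemma recursive_hdc:
  assumes "recursive n f"
  shows "recursive n (\<lambda>xs. hdc (f xs))"
  unfolding hdc_def by (intro recursive_prod_decode recursive_pred assms)

lemma recursive_tlc:
  assumes "recursive n f"
  shows "recursive n (\<lambda>xs. tlc (f xs))"
  unfolding tlc_def by (intro recursive_prod_decode recursive_pred assms)

lemma recursive_consc:
  assumes "recursive n f" "recursive n g"
  shows "recursive n (\<lambda>xs. consc (f xs) (g xs))"
  unfolding consc_def prod_encode_def
  by (simp, intro recursive_Suc recursive_add recursive_triangle assms)

lemma recursive_tlc_funpow:
  assumes "recursive n f" "recursive n g"
  shows "recursive n (\<lambda>xs. (tlc ^^ g xs) (f xs))"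
proof -
  have "recursive n (\<lambda>xs. rec_nat (f xs) (\<lambda>k v. tlc ((k # v # xs) ! 1)) (g xs))"
    by (rule recursive_rec_nat[where g = "\<lambda>ys. tlc (ys ! 1)"])
      (intro assms recursive_tlc rec_proj; simp)+
  moreover have "rec_nat a (\<lambda>k v. tlc v) b = (tlc ^^ b) a" for a b :: nat
    by (induction b) auto
  ultimately show ?thesis by simp
qed


section \<open>A first-order programming language\<close>

text \<open>
  A program is a single expression \<open>B\<close>, the body of one recursive function of one argument;
  \<open>ECall\<close> calls that function.
\<close>

datatype exp = EArg | EConst nat | ECons exp exp | EHd exp | ETl exp | ESuc exp | EEq exp exp
  | EIf exp exp exp | ECall exp

text \<open>\<open>\<phi>\<close> answers the recursive calls. A conditional evaluates only the
  chosen branch, so a call in the other one may be undefined; conjunction and disjunction built from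
  \<open>EIf\<close> inherit this, and the termination of the search relies on it.\<close>

primrec evalx :: "(nat \<Rightarrow> nat option) \<Rightarrow> exp \<Rightarrow> nat \<Rightarrow> nat option" where
  "evalx \<phi> EArg a = Some a"
| "evalx \<phi> (EConst c) a = Some c"
| "evalx \<phi> (ECons e1 e2) a =
     Option.bind (evalx \<phi> e1 a) (\<lambda>x. Option.bind (evalx \<phi> e2 a) (\<lambda>y. Some (consc x y)))"
| "evalx \<phi> (EHd e) a = Option.bind (evalx \<phi> e a) (\<lambda>x. Some (hdc x))"
| "evalx \<phi> (ETl e) a = Option.bind (evalx \<phi> e a) (\<lambda>x. Some (tlc x))"
| "evalx \<phi> (ESuc e) a = Option.bind (evalx \<phi> e a) (\<lambda>x. Some (Suc x))"
| "evalx \<phi> (EEq e1 e2) a =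
     Option.bind (evalx \<phi> e1 a) (\<lambda>x. Option.bind (evalx \<phi> e2 a) (\<lambda>y. Some (of_bool (x = y))))"
| "evalx \<phi> (EIf e1 e2 e3) a =
     Option.bind (evalx \<phi> e1 a) (\<lambda>x. if x \<noteq> 0 then evalx \<phi> e2 a else evalx \<phi> e3 a)"
| "evalx \<phi> (ECall e) a = Option.bind (evalx \<phi> e a) \<phi>"

text \<open>An entry may use only the entries behind it, so justification is never circular and a
  valid table is the trace of a terminating computation.\<close>

primrec valid_table :: "exp \<Rightarrow> (nat \<times> nat) list \<Rightarrow> bool" where
  "valid_table B [] = True"
| "valid_table B (p # T) \<longleftrightarrow> valid_table B T \<and> evalx (map_of T) B (fst p) = Some (snd p)"

definition sem :: "exp \<Rightarrow> nat \<Rightarrow> nat option" where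
  "sem B a = (if \<exists>T v. valid_table B T \<and> map_of T a = Some v
     then Some (SOME v. \<exists>T. valid_table B T \<and> map_of T a = Some v) else None)"

lemma evalx_mono:
  assumes "\<phi> \<subseteq>\<^sub>m \<psi>"
  shows "evalx \<phi> e a = Some v \<Longrightarrow> evalx \<psi> e a = Some v"
proof (induction e arbitrary: v)
  case (ECall e)
  from ECall.prems obtain x where x: "evalx \<phi> e a = Some x" "\<phi> x = Some v"
    by (auto simp: Option.bind_eq_Some_conv)
  then have "\<psi> x = Some v" using assms by (metis domI map_le_def)
  then show ?case using ECall.IH[OF x(1)] by simp
next
  case (EIf e1 e2 e3)
  from EIf.prems obtain x where x: "evalx \<phi> e1 a = Some x" by (auto simp: Option.bind_eq_Some_conv)
  then show ?case using EIf.prems EIf.IH(1)[OF x] EIf.IH(2,3)[of v] by (cases "x = 0") auto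
qed (auto simp: Option.bind_eq_Some_conv)

text \<open>Two valid tables need not extend one another. Agreement on common arguments suffices,
  because both evaluations then ask the same calls in the same order.\<close>

lemma evalx_compatible:
  assumes "\<And>a v w. \<phi> a = Some v \<Longrightarrow> \<psi> a = Some w \<Longrightarrow> v = w"
  shows "evalx \<phi> e a = Some v \<Longrightarrow> evalx \<psi> e a = Some w \<Longrightarrow> v = w"
proof (induction e arbitrary: v w)
  case (ECall e)
  from ECall.prems obtain x y where "evalx \<phi> e a = Some x" "\<phi> x = Some v" "evalx \<psi> e a = Some y" "\<psi> y = Some w"
    by (auto simp: Option.bind_eq_Some_conv)
  then show ?case using ECall.IH[of x y] assms by blast
next
  case (EIf e1 e2 e3)
  from EIf.prems obtain x y where xy: "evalx \<phi> e1 a = Some x" "evalx \<psi> e1 a = Some y"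
    by (auto simp: Option.bind_eq_Some_conv)
  then have "x = y" by (rule EIf.IH(1))
  then show ?case using EIf.prems EIf.IH(2,3)[of v w] xy by (cases "x = 0") auto
next
  case (ECons e1 e2)
  from ECons.prems obtain x1 x2 y1 y2 where "evalx \<phi> e1 a = Some x1" "evalx \<phi> e2 a = Some x2"
    "evalx \<psi> e1 a = Some y1" "evalx \<psi> e2 a = Some y2" "v = consc x1 x2" "w = consc y1 y2"
    by (auto simp: Option.bind_eq_Some_conv)
  then show ?case using ECons.IH(1)[of x1 y1] ECons.IH(2)[of x2 y2] by simp
next
  case (EEq e1 e2)
  from EEq.prems obtain x1 x2 y1 y2 where "evalx \<phi> e1 a = Some x1" "evalx \<phi> e2 a = Some x2"
    "evalx \<psi> e1 a = Some y1" "evalx \<psi> e2 a = Some y2" "v = of_bool (x1 = x2)" "w = of_bool (y1 = y2)"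
    by (auto simp: Option.bind_eq_Some_conv)
  then show ?case using EEq.IH(1)[of x1 y1] EEq.IH(2)[of x2 y2] by simp
next
  case (EHd e)
  from EHd.prems obtain x y where "evalx \<phi> e a = Some x" "evalx \<psi> e a = Some y" "v = hdc x" "w = hdc y"
    by (auto simp: Option.bind_eq_Some_conv)
  then show ?case using EHd.IH[of x y] by simp
next
  case (ETl e)
  from ETl.prems obtain x y where "evalx \<phi> e a = Some x" "evalx \<psi> e a = Some y" "v = tlc x" "w = tlc y"
    by (auto simp: Option.bind_eq_Some_conv)
  then show ?case using ETl.IH[of x y] by simp
next
  case (ESuc e)
  from ESuc.prems obtain x y where "evalx \<phi> e a = Some x" "evalx \<psi> e a = Some y" "v = Suc x" "w = Suc y"
    by (auto simp: Option.bind_eq_Some_conv)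
  then show ?case using ESuc.IH[of x y] by simp
qed simp_all

lemma map_le_map_of_append: "map_of T \<subseteq>\<^sub>m map_of (T @ T')"
  by (auto simp: map_le_def map_add_def split: option.split)

text \<open>An entry of \<open>T\<close> was justified by a suffix of \<open>T\<close>; appending
  \<open>T'\<close> only extends that suffix, and evaluation is monotone.\<close>

lemma valid_table_append: "valid_table B T \<Longrightarrow> valid_table B T' \<Longrightarrow> valid_table B (T @ T')"
proof (induction T)
  case (Cons p T)
  then show ?case
    using evalx_mono[OF map_le_map_of_append, of T B "fst p" "snd p" T'] by (simp del: map_of_append)
qed simp

lemma valid_table_suffix:
  assumes "valid_table B T" "map_of T a = Some v"
  shows "\<exists>T'. valid_table B T' \<and> evalx (map_of T') B a = Some v"
  using assms by (induction T) (auto split: if_splits)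

text \<open>The value of the front entry of \<open>T\<close> comes from evaluating the body over the
  tail of \<open>T\<close>, and the other value from evaluating it over some valid table. By
  induction the tail is compatible with every valid table.\<close>

lemma valid_table_functional:
  "valid_table B T \<Longrightarrow> valid_table B T' \<Longrightarrow> map_of T a = Some v \<Longrightarrow> map_of T' a = Some w \<Longrightarrow> v = w"
proof (induction T arbitrary: T' a v w)
  case (Cons p T)
  show ?case
  proof (cases "a = fst p")
    case True
    obtain T'' where T'': "valid_table B T''" "evalx (map_of T'') B a = Some w"
      using valid_table_suffix Cons.prems by blast
    have "evalx (map_of T) B a = Some v" using Cons.prems True by simp
    then show ?thesis
      using evalx_compatible[of "map_of T" "map_of T''" B a v w] Cons.IH[OF _ T''(1)] Cons.prems T''(2)
      by auto
  next
    case False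
    then show ?thesis using Cons by auto
  qed
qed simp

lemma sem_eq_Some_iff: "sem B a = Some v \<longleftrightarrow> (\<exists>T. valid_table B T \<and> map_of T a = Some v)"
proof
  assume "sem B a = Some v"
  then have "\<exists>v T. valid_table B T \<and> map_of T a = Some v"
    and "v = (SOME v. \<exists>T. valid_table B T \<and> map_of T a = Some v)"
    unfolding sem_def by (auto split: if_splits)
  then show "\<exists>T. valid_table B T \<and> map_of T a = Some v"
    using someI_ex[of "\<lambda>v. \<exists>T. valid_table B T \<and> map_of T a = Some v"] by simp
next
  assume ex: "\<exists>T. valid_table B T \<and> map_of T a = Some v"
  then have "(SOME v. \<exists>T. valid_table B T \<and> map_of T a = Some v) = v"
    by (rule some_equality) (use ex valid_table_functional in blast)
  with ex show "sem B a = Some v" unfolding sem_def by auto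
qed

text \<open>A successful evaluation makes finitely many calls, so finitely many tables have to be
  joined. \<open>T0\<close> carries the table already gathered for earlier subexpressions.\<close>

lemma evalx_sem_table:
  "evalx (sem B) e a = Some v \<Longrightarrow> valid_table B T0 \<Longrightarrow>
   \<exists>T. valid_table B T \<and> map_of T0 \<subseteq>\<^sub>m map_of T \<and> evalx (map_of T) e a = Some v"
proof (induction e arbitrary: v T0)
  case (ECall e)
  from ECall.prems obtain x where x: "evalx (sem B) e a = Some x" "sem B x = Some v"
    by (auto simp: Option.bind_eq_Some_conv)
  obtain T1 where T1: "valid_table B T1" "map_of T0 \<subseteq>\<^sub>m map_of T1" "evalx (map_of T1) e a = Some x"
    using ECall.IH[OF x(1) ECall.prems(2)] by blast
  obtain T2 where T2: "valid_table B T2" "map_of T2 x = Some v"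
    using x(2) unfolding sem_eq_Some_iff by blast
  \<comment> \<open>\<open>T1\<close> takes precedence in the joined table; if it already lists
    \<open>x\<close>, uniqueness of values says that it lists \<open>v\<close>.\<close>
  have "map_of (T1 @ T2) x = Some v"
  proof (cases "map_of T1 x")
    case (Some u)
    then have "u = v" using T1(1) T2 valid_table_functional by blast
    then show ?thesis using Some by simp
  qed (use T2 in \<open>simp add: map_add_def\<close>)
  moreover have "evalx (map_of (T1 @ T2)) e a = Some x"
    using evalx_mono[OF map_le_map_of_append T1(3)] .
  ultimately show ?case
    using valid_table_append[OF T1(1) T2(1)] map_le_trans[OF T1(2) map_le_map_of_append]
    by (intro exI[of _ "T1 @ T2"]) (auto simp del: map_of_append)
next
  case (EIf e1 e2 e3)
  from EIf.prems obtain x where x: "evalx (sem B) e1 a = Some x"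
    by (auto simp: Option.bind_eq_Some_conv)
  obtain T1 where T1: "valid_table B T1" "map_of T0 \<subseteq>\<^sub>m map_of T1" "evalx (map_of T1) e1 a = Some x"
    using EIf.IH(1)[OF x EIf.prems(2)] by blast
  have "\<exists>T. valid_table B T \<and> map_of T1 \<subseteq>\<^sub>m map_of T \<and>
      evalx (map_of T) (if x \<noteq> 0 then e2 else e3) a = Some v"
    using EIf.prems(1) EIf.IH(2,3)[OF _ T1(1)] x by (cases "x = 0") auto
  then obtain T2 where "valid_table B T2" "map_of T1 \<subseteq>\<^sub>m map_of T2"
    "evalx (map_of T2) (if x \<noteq> 0 then e2 else e3) a = Some v" by blast
  then show ?case using T1 map_le_trans[OF T1(2)] evalx_mono[OF _ T1(3)]
    by (intro exI[of _ T2]) auto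
next
  case (ECons e1 e2)
  from ECons.prems obtain x y where xy: "evalx (sem B) e1 a = Some x" "evalx (sem B) e2 a = Some y" "v = consc x y"
    by (auto simp: Option.bind_eq_Some_conv)
  obtain T1 where T1: "valid_table B T1" "map_of T0 \<subseteq>\<^sub>m map_of T1" "evalx (map_of T1) e1 a = Some x"
    using ECons.IH(1)[OF xy(1) ECons.prems(2)] by blast
  obtain T2 where "valid_table B T2" "map_of T1 \<subseteq>\<^sub>m map_of T2" "evalx (map_of T2) e2 a = Some y"
    using ECons.IH(2)[OF xy(2) T1(1)] by blast
  then show ?case using T1 xy(3) map_le_trans[OF T1(2)] evalx_mono[OF _ T1(3)]
    by (intro exI[of _ T2]) auto
next
  case (EEq e1 e2)
  from EEq.prems obtain x y where xy: "evalx (sem B) e1 a = Some x" "evalx (sem B) e2 a = Some y"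
      "v = of_bool (x = y)"
    by (auto simp: Option.bind_eq_Some_conv)
  obtain T1 where T1: "valid_table B T1" "map_of T0 \<subseteq>\<^sub>m map_of T1" "evalx (map_of T1) e1 a = Some x"
    using EEq.IH(1)[OF xy(1) EEq.prems(2)] by blast
  obtain T2 where "valid_table B T2" "map_of T1 \<subseteq>\<^sub>m map_of T2" "evalx (map_of T2) e2 a = Some y"
    using EEq.IH(2)[OF xy(2) T1(1)] by blast
  then show ?case using T1 xy(3) map_le_trans[OF T1(2)] evalx_mono[OF _ T1(3)]
    by (intro exI[of _ T2]) auto
next
  case (EHd e)
  from EHd.prems obtain x where "evalx (sem B) e a = Some x" "v = hdc x"
    by (auto simp: Option.bind_eq_Some_conv)
  then show ?case using EHd.IH[of x T0] EHd.prems(2) by auto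
next
  case (ETl e)
  from ETl.prems obtain x where "evalx (sem B) e a = Some x" "v = tlc x"
    by (auto simp: Option.bind_eq_Some_conv)
  then show ?case using ETl.IH[of x T0] ETl.prems(2) by auto
next
  case (ESuc e)
  from ESuc.prems obtain x where "evalx (sem B) e a = Some x" "v = Suc x"
    by (auto simp: Option.bind_eq_Some_conv)
  then show ?case using ESuc.IH[of x T0] ESuc.prems(2) by auto
qed auto

text \<open>In one direction the table behind an entry is part of \<open>sem B\<close>; in the
  other, the table gathered by \<open>evalx_sem_table\<close> justifies a new front entry for
  \<open>a\<close>.\<close>

theorem sem_unfold: "sem B a = evalx (sem B) B a"
proof -
  have "sem B a = Some v \<longleftrightarrow> evalx (sem B) B a = Some v" for v
  proof
    assume "sem B a = Some v"
    then obtain T where T: "valid_table B T" "evalx (map_of T) B a = Some v"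
      using valid_table_suffix sem_eq_Some_iff by metis
    have "map_of T \<subseteq>\<^sub>m sem B"
      unfolding map_le_def using T(1) sem_eq_Some_iff by (metis domD)
    then show "evalx (sem B) B a = Some v" using T(2) evalx_mono by blast
  next
    assume "evalx (sem B) B a = Some v"
    then obtain T where "valid_table B T" "evalx (map_of T) B a = Some v"
      using evalx_sem_table[of B B a v "[]"] by auto
    then have "valid_table B ((a, v) # T)" "map_of ((a, v) # T) a = Some v" by auto
    then show "sem B a = Some v" unfolding sem_eq_Some_iff by blast
  qed
  then show ?thesis by (metis option.exhaust)
qed

section \<open>Evaluation over an encoded table is recursive\<close>

definition dec_table :: "nat \<Rightarrow> (nat \<times> nat) list" where
  "dec_table T = map (\<lambda>p. (hdc p, tlc p)) (list_decode T)"

definition enc_option :: "nat option \<Rightarrow> nat" where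
  "enc_option u = (case u of None \<Rightarrow> 0 | Some v \<Rightarrow> Suc v)"

lemma enc_option_simps [simp]:
  "enc_option None = 0" "enc_option (Some v) = Suc v" "enc_option u = Suc v \<longleftrightarrow> u = Some v"
  "enc_option u = 0 \<longleftrightarrow> u = None"
  by (auto simp: enc_option_def split: option.splits)

lemma tlc_funpow: "(tlc ^^ k) T = list_encode (drop k (list_decode T))"
proof -
  have "(tlc ^^ k) (list_encode xs) = list_encode (drop k xs)" for xs
  proof (induction k)
    case (Suc k)
    have "tlc (list_encode ys) = list_encode (tl ys)" for ys by (cases ys) (auto simp: list_encode_Nil)
    then show ?case using Suc by (simp add: drop_Suc tl_drop)
  qed simp
  then show ?thesis by (metis list_decode_inverse)
qed

lemma dec_table_tlc_funpow: "dec_table ((tlc ^^ k) T) = drop k (dec_table T)"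
  by (simp add: dec_table_def tlc_funpow drop_map)

lemma tlc_funpow_eq_0: "(tlc ^^ k) T = 0 \<longleftrightarrow> length (dec_table T) \<le> k"
  by (simp add: tlc_funpow dec_table_def)

lemma hdc_tlc_funpow:
  "k < length (dec_table T) \<Longrightarrow>
   hdc (hdc ((tlc ^^ k) T)) = fst (dec_table T ! k) \<and> tlc (hdc ((tlc ^^ k) T)) = snd (dec_table T ! k)"
  by (simp add: tlc_funpow dec_table_def Cons_nth_drop_Suc[symmetric])

lemma map_of_first:
  "k < length T \<Longrightarrow> fst (T ! k) = a \<Longrightarrow> (\<And>j. j < k \<Longrightarrow> fst (T ! j) \<noteq> a) \<Longrightarrow>
   map_of T a = Some (snd (T ! k))"
proof (induction T arbitrary: k)
  case (Cons p T)
  show ?case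
  proof (cases k)
    case (Suc j)
    have "fst p \<noteq> a" using Cons.prems(3)[of 0] Suc by simp
    moreover have "map_of T a = Some (snd (T ! j))"
      using Cons.IH[of j] Cons.prems(1,2) Cons.prems(3)[of "Suc _"] Suc by simp
    ultimately show ?thesis using Suc by simp
  qed (use Cons in auto)
qed simp

text \<open>Minimization finds the first position where the table has ended or the key matches; the
  first alternative guarantees that such a position exists.\<close>

lemma recursive_lookup:
  assumes "recursive n f" "recursive n g"
  shows "recursive n (\<lambda>xs. enc_option (map_of (dec_table (f xs)) (g xs)))"
proof -
  let ?P = "\<lambda>ys. (tlc ^^ (ys ! 0)) (f (tl ys)) = 0 \<or> hdc (hdc ((tlc ^^ (ys ! 0)) (f (tl ys)))) = g (tl ys)"
  let ?k = "\<lambda>xs. LEAST k. ?P (k # xs)"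
  have P: "\<exists>k. ?P (k # xs)" for xs
    by (rule exI[of _ "length (dec_table (f xs))"]) (simp add: tlc_funpow_eq_0)
  have "rec_pred (Suc n) ?P"
    by (intro rec_pred_disj rec_pred_eq rec_pred_eq0 recursive_hdc recursive_tlc_funpow
        rec_proj recursive_tl[OF assms(1)] recursive_tl[OF assms(2)]) simp_all
  then have k: "recursive n ?k" using P by (rule recursive_Least)
  have "recursive n (\<lambda>xs. if (tlc ^^ ?k xs) (f xs) = 0 then 0
      else Suc (tlc (hdc ((tlc ^^ ?k xs) (f xs)))))"
    by (intro recursive_If rec_pred_eq0 recursive_Suc recursive_tlc recursive_hdc
        recursive_tlc_funpow recursive_const k assms)
  then show ?thesis
  proof (rule recursive_cong)
    fix xs :: "nat list"
    define k where "k = ?k xs"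
    define T where "T = dec_table (f xs)"
    have least: "\<not> ?P (j # xs)" if "j < k" for j
      using that not_less_Least unfolding k_def by blast
    have Pk: "?P (k # xs)" unfolding k_def by (rule LeastI_ex[OF P])
    have before: "fst (T ! j) \<noteq> g xs" if "j < k" for j
      using least[OF that] hdc_tlc_funpow[of j "f xs"] by (auto simp: tlc_funpow_eq_0 T_def)
    have "enc_option (map_of T (g xs)) = (if (tlc ^^ k) (f xs) = 0 then 0
      else Suc (tlc (hdc ((tlc ^^ k) (f xs)))))"
    proof (cases "(tlc ^^ k) (f xs) = 0")
      case True
      then have "length T \<le> k" by (simp add: tlc_funpow_eq_0 T_def)
      then have "map_of T (g xs) = None"
        using before by (auto simp: map_of_eq_None_iff in_set_conv_nth) (metis fst_conv order_less_le_trans)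
      then show ?thesis using True by simp
    next
      case False
      then have "k < length T" by (simp add: tlc_funpow_eq_0 T_def not_le)
      then have "map_of T (g xs) = Some (snd (T ! k))"
        using Pk False before hdc_tlc_funpow[of k "f xs"] by (intro map_of_first) (auto simp: T_def)
      then show ?thesis using False \<open>k < length T\<close> hdc_tlc_funpow[of k "f xs"] by (simp add: T_def)
    qed
    then show "enc_option (map_of (dec_table (f xs)) (g xs)) = (if (tlc ^^ ?k xs) (f xs) = 0 then 0
      else Suc (tlc (hdc ((tlc ^^ ?k xs) (f xs)))))"
      unfolding k_def T_def .
  qed
qed

lemma recursive_evalx:
  assumes f: "recursive n f" and g: "recursive n g"
  shows "recursive n (\<lambda>xs. enc_option (evalx (map_of (dec_table (f xs))) e (g xs)))"
proof (induction e)
  case EArg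
  then show ?case by (simp add: recursive_Suc g)
next
  case (EConst c)
  then show ?case by (simp add: recursive_const)
next
  case (ECons e1 e2)
  let ?v1 = "\<lambda>xs. enc_option (evalx (map_of (dec_table (f xs))) e1 (g xs))"
  let ?v2 = "\<lambda>xs. enc_option (evalx (map_of (dec_table (f xs))) e2 (g xs))"
  have "recursive n (\<lambda>xs. if ?v1 xs = 0 \<or> ?v2 xs = 0 then 0 else Suc (consc (?v1 xs - 1) (?v2 xs - 1)))"
    by (intro recursive_If rec_pred_disj rec_pred_eq0 recursive_Suc recursive_const recursive_consc
        recursive_pred ECons)
  then show ?case by (rule recursive_cong) (auto simp: enc_option_def split: option.split)
next
  case (EEq e1 e2)
  let ?v1 = "\<lambda>xs. enc_option (evalx (map_of (dec_table (f xs))) e1 (g xs))"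
  let ?v2 = "\<lambda>xs. enc_option (evalx (map_of (dec_table (f xs))) e2 (g xs))"
  \<comment> \<open>Under \<open>enc_option\<close> the truth values 1 and 0 become 2 and 1.\<close>
  have "recursive n (\<lambda>xs. if ?v1 xs = 0 \<or> ?v2 xs = 0 then 0 else if ?v1 xs = ?v2 xs then 2 else 1)"
    by (intro recursive_If rec_pred_disj rec_pred_eq0 rec_pred_eq recursive_const EEq)
  then show ?case by (rule recursive_cong) (auto simp: enc_option_def split: option.split)
next
  case (EIf e1 e2 e3)
  let ?v = "\<lambda>e xs. enc_option (evalx (map_of (dec_table (f xs))) e (g xs))"
  \<comment> \<open>Code 0 is an undefined test, and code 1 is a test with value 0, hence the else
    branch.\<close>
  have "recursive n (\<lambda>xs. if ?v e1 xs = 0 then 0 else if ?v e1 xs = 1 then ?v e3 xs else ?v e2 xs)"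
    by (intro recursive_If rec_pred_eq0 rec_pred_eq recursive_const EIf)
  then show ?case by (rule recursive_cong) (auto simp: enc_option_def split: option.split)
next
  case (EHd e)
  let ?v = "\<lambda>xs. enc_option (evalx (map_of (dec_table (f xs))) e (g xs))"
  have "recursive n (\<lambda>xs. if ?v xs = 0 then 0 else Suc (hdc (?v xs - 1)))"
    by (intro recursive_If rec_pred_eq0 recursive_Suc recursive_const recursive_hdc recursive_pred EHd)
  then show ?case by (rule recursive_cong) (auto simp: enc_option_def split: option.split)
next
  case (ETl e)
  let ?v = "\<lambda>xs. enc_option (evalx (map_of (dec_table (f xs))) e (g xs))"
  have "recursive n (\<lambda>xs. if ?v xs = 0 then 0 else Suc (tlc (?v xs - 1)))"
    by (intro recursive_If rec_pred_eq0 recursive_Suc recursive_const recursive_tlc recursive_pred ETl)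
  then show ?case by (rule recursive_cong) (auto simp: enc_option_def split: option.split)
next
  case (ESuc e)
  let ?v = "\<lambda>xs. enc_option (evalx (map_of (dec_table (f xs))) e (g xs))"
  have "recursive n (\<lambda>xs. if ?v xs = 0 then 0 else Suc (?v xs))"
    by (intro recursive_If rec_pred_eq0 recursive_Suc recursive_const ESuc)
  then show ?case by (rule recursive_cong) (auto simp: enc_option_def split: option.split)
next
  case (ECall e)
  let ?v = "\<lambda>xs. enc_option (evalx (map_of (dec_table (f xs))) e (g xs))"
  have "recursive n (\<lambda>xs. if ?v xs = 0 then 0
      else enc_option (map_of (dec_table (f xs)) (?v xs - 1)))"
    by (intro recursive_If rec_pred_eq0 recursive_const recursive_lookup recursive_pred f ECall)
  then show ?case by (rule recursive_cong) (auto simp: enc_option_def split: option.split)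
qed

lemma valid_table_iff:
  "valid_table B T \<longleftrightarrow>
   (\<forall>k < length T. evalx (map_of (drop (Suc k) T)) B (fst (T ! k)) = Some (snd (T ! k)))"
  by (induction T) (auto simp: All_less_Suc2)

text \<open>A list is no longer than its code, so \<open>f xs\<close> itself bounds the positions to
  be checked; those past the end satisfy \<open>?P\<close> by its first alternative.\<close>

lemma rec_pred_valid_table:
  assumes f: "recursive n f"
  shows "rec_pred n (\<lambda>xs. valid_table B (dec_table (f xs)))"
proof -
  let ?s = "\<lambda>ys. (tlc ^^ (ys ! 0)) (f (tl ys))"
  let ?P = "\<lambda>ys. ?s ys = 0 \<or> enc_option (evalx (map_of (dec_table (tlc (?s ys)))) B (hdc (hdc (?s ys))))
      = Suc (tlc (hdc (?s ys)))"
  have s: "recursive (Suc n) ?s"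
    by (intro recursive_tlc_funpow rec_proj recursive_tl[OF f]) simp
  have "rec_pred (Suc n) ?P"
    by (intro rec_pred_disj rec_pred_eq0 rec_pred_eq recursive_evalx recursive_Suc recursive_tlc
        recursive_hdc s)
  then have "rec_pred n (\<lambda>xs. \<forall>k < f xs. ?P (k # xs))"
    by (rule rec_pred_all_less[OF _ f])
  moreover have "(\<forall>k < f xs. ?P (k # xs)) \<longleftrightarrow> valid_table B (dec_table (f xs))" for xs
  proof -
    have len: "length (dec_table (f xs)) \<le> f xs"
      using length_le_list_encode[of "list_decode (f xs)"] by (simp add: dec_table_def)
    have "?P (k # xs) \<longleftrightarrow> (k < length (dec_table (f xs)) \<longrightarrow>
       evalx (map_of (drop (Suc k) (dec_table (f xs)))) B (fst (dec_table (f xs) ! k))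
         = Some (snd (dec_table (f xs) ! k)))" for k
      using dec_table_tlc_funpow[of "Suc k" "f xs"] hdc_tlc_funpow[of k "f xs"]
      by (cases "k < length (dec_table (f xs))") (auto simp: tlc_funpow_eq_0)
    then show ?thesis unfolding valid_table_iff using len by (meson order_less_le_trans)
  qed
  ultimately show ?thesis by simp
qed

text \<open>Every number decodes to a table, so minimization over numbers searches all tables for a
  valid one whose front entry answers \<open>f xs\<close>. Totality makes the search regular, and
  uniqueness of values makes it irrelevant which table is found.\<close>

theorem recursive_sem:
  assumes f: "recursive n f" and total: "\<And>xs. length xs = n \<Longrightarrow> sem B (f xs) \<noteq> None"
  shows "recursive n (\<lambda>xs. the (sem B (f xs)))"
proof -
  let ?P = "\<lambda>ys. valid_table B (dec_table (ys ! 0)) \<and> ys ! 0 \<noteq> 0 \<and> hdc (hdc (ys ! 0)) = f (tl ys)"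
  let ?T = "\<lambda>xs. LEAST T. ?P (T # xs)"
  have ex: "\<exists>T. ?P (T # xs)" if "length xs = n" for xs
  proof -
    from total[OF that] obtain v where "sem B (f xs) = Some v" by blast
    then obtain T where T: "valid_table B T" "evalx (map_of T) B (f xs) = Some v"
      using valid_table_suffix unfolding sem_eq_Some_iff by blast
    \<comment> \<open>The table \<open>T\<close> justifies the value \<open>v\<close>, so the wanted
      entry can be put in front of it.\<close>
    define t where "t = list_encode (map (\<lambda>p. consc (fst p) (snd p)) ((f xs, v) # T))"
    have "dec_table t = (f xs, v) # T" unfolding t_def dec_table_def by (simp add: comp_def)
    moreover have "t \<noteq> 0" "hdc (hdc t) = f xs" unfolding t_def by simp_all
    ultimately have "?P (t # xs)" using T by simp
    then show ?thesis by blast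
  qed
  have "rec_pred (Suc n) ?P"
    by (intro rec_pred_conj rec_pred_not rec_pred_eq0 rec_pred_eq rec_pred_valid_table recursive_hdc
        recursive_tl[OF f] rec_proj) simp_all
  then have T: "recursive n ?T" using ex by (rule recursive_Least)
  then have "recursive n (\<lambda>xs. tlc (hdc (?T xs)))"
    by (intro recursive_tlc recursive_hdc)
  then show ?thesis
  proof (rule recursive_cong)
    fix xs :: "nat list" assume "length xs = n"
    define T where "T = ?T xs"
    have P: "?P (T # xs)" unfolding T_def by (rule LeastI_ex[OF ex[OF \<open>length xs = n\<close>]])
    then have "0 < length (dec_table T)" using tlc_funpow_eq_0[of 0 T] by auto
    with P hdc_tlc_funpow[of 0 T] have "dec_table T ! 0 = (f xs, tlc (hdc T))"
      by (metis (mono_tags, lifting) funpow_0 list.sel(3) nth_Cons_0 prod.collapse)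
    then have "map_of (dec_table T) (f xs) = Some (tlc (hdc T))"
      using \<open>0 < length (dec_table T)\<close> by (cases "dec_table T") auto
    then have "sem B (f xs) = Some (tlc (hdc T))" using P unfolding sem_eq_Some_iff by auto
    then show "the (sem B (f xs)) = tlc (hdc (?T xs))" unfolding T_def by simp
  qed
qed


section \<open>Renaming, opening and unfolding\<close>

lemma finite_fv_var [simp]: "finite (fv_var v)" by (cases v) auto
lemma finite_fv_head [simp]: "finite (fv_head H)" by (cases H) auto
lemma finite_fv_tm [simp]: "finite (fv_tm M)" and finite_fv_sp [simp]: "finite (fv_sp S)"
  by (induction M and S) auto

lemma ren_var_comp: "ren_var f (ren_var g v) = ren_var (f \<circ> g) v" by (cases v) auto
lemma ren_head_comp: "ren_head f (ren_head g H) = ren_head (f \<circ> g) H"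
  by (cases H) (auto simp: ren_var_comp)
lemma ren_tm_comp: "ren_tm f (ren_tm g M) = ren_tm (f \<circ> g) M"
  and ren_sp_comp: "ren_sp f (ren_sp g S) = ren_sp (f \<circ> g) S"
  by (induction M and S) (auto simp: ren_var_comp ren_head_comp comp_def)

lemma ren_var_cong: "(\<And>x. x \<in> fv_var v \<Longrightarrow> f x = g x) \<Longrightarrow> ren_var f v = ren_var g v"
  by (cases v) auto
lemma ren_head_cong: "(\<And>x. x \<in> fv_head H \<Longrightarrow> f x = g x) \<Longrightarrow> ren_head f H = ren_head g H"
  by (cases H) (auto intro: ren_var_cong)
lemma ren_tm_cong: "(\<And>x. x \<in> fv_tm M \<Longrightarrow> f x = g x) \<Longrightarrow> ren_tm f M = ren_tm g M"
  and ren_sp_cong: "(\<And>x. x \<in> fv_sp S \<Longrightarrow> f x = g x) \<Longrightarrow> ren_sp f S = ren_sp g S"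
  by (induction M and S) (auto intro: ren_var_cong ren_head_cong)

lemma ren_var_id [simp]: "ren_var id v = v" by (cases v) auto
lemma ren_head_id [simp]: "ren_head id H = H" by (cases H) auto
lemma ren_tm_id [simp]: "ren_tm id M = M" and ren_sp_id [simp]: "ren_sp id S = S"
  by (induction M and S) (auto simp: id_def[symmetric])

lemma ren_head_fresh: "(\<And>x. x \<in> fv_head H \<Longrightarrow> f x = x) \<Longrightarrow> ren_head f H = H"
  using ren_head_cong[of H f id] by simp
lemma ren_tm_fresh: "(\<And>x. x \<in> fv_tm M \<Longrightarrow> f x = x) \<Longrightarrow> ren_tm f M = M"
  and ren_sp_fresh: "(\<And>x. x \<in> fv_sp S \<Longrightarrow> f x = x) \<Longrightarrow> ren_sp f S = S"
  using ren_tm_cong[of M f id] ren_sp_cong[of S f id] by simp_all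

lemma fv_ren_var: "fv_var (ren_var f v) = f ` fv_var v" by (cases v) auto
lemma fv_ren_head: "fv_head (ren_head f H) = f ` fv_head H" by (cases H) (auto simp: fv_ren_var)
lemma fv_ren_tm: "fv_tm (ren_tm f M) = f ` fv_tm M" and fv_ren_sp: "fv_sp (ren_sp f S) = f ` fv_sp S"
  by (induction M and S) (auto simp: fv_ren_var fv_ren_head)

lemma ren_opn_var: "ren_var f (opn_var k x v) = opn_var k (f x) (ren_var f v)" by (cases v) auto
lemma ren_opn_head: "ren_head f (opn_head k x H) = opn_head k (f x) (ren_head f H)"
  by (cases H) (auto simp: ren_opn_var)
lemma ren_opn_tm: "ren_tm f (opn_tm k x M) = opn_tm k (f x) (ren_tm f M)"
  and ren_opn_sp: "ren_sp f (opn_sp k x S) = opn_sp k (f x) (ren_sp f S)"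
  by (induction M and S arbitrary: k and k) (auto simp: ren_opn_var ren_opn_head)

lemma ren_opn_fresh: "x \<notin> fv_tm M \<Longrightarrow> ren_tm (id(x := y)) (opn_tm k x M) = opn_tm k y M"
  by (subst ren_opn_tm, subst ren_tm_fresh) auto

lemma spine_induct [case_names SNil SArg SPre]:
  assumes "P SNil" "\<And>M S. P S \<Longrightarrow> P (SArg M S)" "\<And>v S. P S \<Longrightarrow> P (SPre v S)"
  shows "P S"
  by (rule spine.induct[where ?P1.0 = "\<lambda>_. True" and ?P2.0 = P]) (use assms in auto)

lemma prepat_ren_sp [simp]: "prepat (ren_sp f S) = prepat S"
  by (induction S rule: spine_induct) auto

text \<open>On a prepattern spine \<open>rhd\<close> performs no hereditary substitution: each
  argument is a variable that can directly replace the bound index. The fresh intermediate name of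
  \<open>rhd_pre\<close> disappears, and the relation becomes a function.\<close>

primrec unfold :: "spine \<Rightarrow> sty \<Rightarrow> tm \<Rightarrow> tm option" where
  "unfold SNil = (\<lambda>\<tau> M. case (\<tau>, M) of (Base, Neu H S) \<Rightarrow> Some M | _ \<Rightarrow> None)"
| "unfold (SArg N S) = (\<lambda>\<tau> M. None)"
| "unfold (SPre v S) = (\<lambda>\<tau> M. case (v, \<tau>, M) of
     (Free y, Arr Base \<tau>', Lam M') \<Rightarrow> unfold S \<tau>' (opn_tm 0 y M') | _ \<Rightarrow> None)"

lemma unfold_prepat: "unfold S \<tau> M = Some N \<Longrightarrow> prepat S"
  by (induction S arbitrary: \<tau> M rule: spine_induct)
    (auto split: var.splits sty.splits tm.splits)

lemma rhd_imp_unfold: "rhd S \<tau> M N \<Longrightarrow> prepat S \<Longrightarrow> unfold S \<tau> M = Some N"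
proof (induction S arbitrary: \<tau> M rule: spine_induct)
  case (SPre v S)
  from SPre.prems(1) show ?case
  proof cases
    case (rhd_pre x M' \<tau>' y)
    then show ?thesis using SPre.IH[of \<tau>' "opn_tm 0 y M'"] SPre.prems(2) by (simp add: ren_opn_fresh)
  qed
qed (auto elim: rhd.cases)

lemma unfold_imp_rhd: "unfold S \<tau> M = Some N \<Longrightarrow> rhd S \<tau> M N"
proof (induction S arbitrary: \<tau> M rule: spine_induct)
  case (SPre v S)
  then obtain y \<tau>' M' where *: "v = Free y" "\<tau> = Arr Base \<tau>'" "M = Lam M'"
    "unfold S \<tau>' (opn_tm 0 y M') = Some N"
    by (auto split: var.splits sty.splits tm.splits)
  obtain x where "x \<notin> fv_tm M'" using ex_new_if_finite[OF infinite_UNIV_nat finite_fv_tm] by blast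
  then show ?case using SPre.IH[OF *(4)] *(1-3) by (auto intro!: rhd_pre simp: ren_opn_fresh)
qed (auto split: sty.splits tm.splits intro: rhd_nil)

lemma prepat_rhd_iff: "prepat S \<and> rhd S \<tau> M N \<longleftrightarrow> unfold S \<tau> M = Some N"
  using rhd_imp_unfold unfold_imp_rhd unfold_prepat by blast

text \<open>Unfolding moves names about but never compares them, so it commutes with every renaming,
  injective or not.\<close>

lemma unfold_ren: "unfold (ren_sp f S) \<tau> (ren_tm f M) = map_option (ren_tm f) (unfold S \<tau> M)"
proof (induction S arbitrary: \<tau> M rule: spine_induct)
  case (SPre v S)
  then show ?case by (auto split: var.splits sty.splits tm.splits simp: ren_opn_tm[symmetric])
qed (auto split: sty.splits tm.splits)


section \<open>Equivariance of the equality judgment\<close>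

primrec ren_assm :: "(name \<Rightarrow> name) \<Rightarrow> assm \<Rightarrow> assm" where
  "ren_assm f (Assm \<Theta> H S H' S') =
     Assm (map f \<Theta>) (ren_head f H) (ren_sp f S) (ren_head f H') (ren_sp f S')"

lemma names_ren_assm: "names_assm (ren_assm f \<delta>) = f ` names_assm \<delta>"
  by (cases \<delta>) (auto simp: fv_ren_head fv_ren_sp)

lemma ren_assm_fresh:
  assumes "\<And>x. x \<in> names_assm \<delta> \<Longrightarrow> f x = x"
  shows "ren_assm f \<delta> = \<delta>"
proof (cases \<delta>)
  case (Assm \<Theta> H S H' S')
  then show ?thesis using assms by (auto intro!: map_idI ren_head_fresh ren_sp_fresh)
qed

lemma fv_sigI: "RecDecl r A M \<in> set \<Sigma> \<Longrightarrow> x \<in> fv_tm M \<Longrightarrow> x \<in> fv_sig \<Sigma>"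
  unfolding fv_sig_def by blast

lemma ren_sig:
  assumes "RecDecl r A M \<in> set \<Sigma>" "\<And>x. x \<in> fv_sig \<Sigma> \<Longrightarrow> f x = x"
  shows "ren_tm f M = M"
  using assms fv_sigI by (blast intro: ren_tm_fresh)

text \<open>Definitions are fixed by \<open>\<pi>\<close>, so unfolding commutes with it.
  Bijectivity keeps fresh names fresh, and in the assumption rule it allows the renaming to be
  conjugated by \<open>\<pi>\<close>.\<close>

lemma eq_equivariant:
  assumes \<pi>: "bij \<pi>" and sig: "\<And>x. x \<in> fv_sig \<Sigma> \<Longrightarrow> \<pi> x = x"
  shows "eq_tm \<Sigma> \<Delta> \<Theta> M M' \<Longrightarrow>
      eq_tm \<Sigma> (map (ren_assm \<pi>) \<Delta>) (map \<pi> \<Theta>) (ren_tm \<pi> M) (ren_tm \<pi> M')"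
    and "eq_sp \<Sigma> \<Delta> \<Theta> S S' \<Longrightarrow>
      eq_sp \<Sigma> (map (ren_assm \<pi>) \<Delta>) (map \<pi> \<Theta>) (ren_sp \<pi> S) (ren_sp \<pi> S')"
proof (induction rule: eq_tm_eq_sp.inducts)
  case (eq_assm \<Theta>' H S1 H' S2 \<Delta> \<Theta> \<sigma>)
  let ?\<sigma> = "\<pi> \<circ> \<sigma> \<circ> inv \<pi>"
  have inv: "inv \<pi> (\<pi> x) = x" "\<pi> (inv \<pi> x) = x" for x
    using \<pi> by (simp_all add: bij_is_inj bij_is_surj surj_f_inv_f)
  have "Assm (map \<pi> \<Theta>') (ren_head \<pi> H) (ren_sp \<pi> S1) (ren_head \<pi> H') (ren_sp \<pi> S2)
      \<in> set (map (ren_assm \<pi>) \<Delta>)"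
    using imageI[OF eq_assm(1), of "ren_assm \<pi>"] by simp
  moreover have "renaming (map \<pi> \<Theta>) ?\<sigma> (map \<pi> \<Theta>')"
    unfolding renaming_def
  proof (intro conjI ballI allI impI)
    fix x assume "x \<in> set (map \<pi> \<Theta>')"
    then show "?\<sigma> x \<in> set (map \<pi> \<Theta>)" using eq_assm(2) unfolding renaming_def by (auto simp: inv)
  next
    fix x assume "x \<notin> set (map \<pi> \<Theta>')"
    then have "inv \<pi> x \<notin> set \<Theta>'" using inv(2)[of x] by force
    then show "?\<sigma> x = x" using eq_assm(2) unfolding renaming_def by (simp add: inv)
  qed
  ultimately have "eq_tm \<Sigma> (map (ren_assm \<pi>) \<Delta>) (map \<pi> \<Theta>)
     (ren_tm ?\<sigma> (Neu (ren_head \<pi> H) (ren_sp \<pi> S1))) (ren_tm ?\<sigma> (Neu (ren_head \<pi> H') (ren_sp \<pi> S2)))"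
    by (rule eq_tm_eq_sp.eq_assm)
  moreover have "?\<sigma> \<circ> \<pi> = \<pi> \<circ> \<sigma>" by (simp add: fun_eq_iff inv)
  ultimately show ?case by (simp add: ren_head_comp ren_sp_comp)
next
  case (eq_unfold_left r A M S1 N \<Delta> \<Theta> H S2)
  have "unfold S1 (erase A) M = Some N"
    using \<open>rhd S1 (erase A) M N\<close> \<open>prepat S1\<close> by (rule rhd_imp_unfold)
  moreover have "ren_tm \<pi> M = M" by (rule ren_sig[OF \<open>RecDecl r A M \<in> set \<Sigma>\<close>]) (rule sig)
  ultimately have rhd: "rhd (ren_sp \<pi> S1) (erase A) M (ren_tm \<pi> N)"
    using unfold_ren[of \<pi> S1 "erase A" M] by (intro unfold_imp_rhd) simp
  have "eq_tm \<Sigma> (map (ren_assm \<pi>) \<Delta>) (map \<pi> \<Theta>) (Neu (Rec r) (ren_sp \<pi> S1))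
      (Neu (ren_head \<pi> H) (ren_sp \<pi> S2))"
    by (rule eq_tm_eq_sp.eq_unfold_left[OF \<open>RecDecl r A M \<in> set \<Sigma>\<close> _ \<open>contra M\<close> rhd])
      (use \<open>prepat S1\<close> eq_unfold_left.IH in \<open>simp_all\<close>)
  then show ?case by simp
next
  case (eq_unfold_right r A M S2 H N \<Delta> \<Theta> S1)
  have "unfold S2 (erase A) M = Some N"
    using \<open>rhd S2 (erase A) M N\<close> \<open>prepat S2\<close> by (rule rhd_imp_unfold)
  moreover have "ren_tm \<pi> M = M" by (rule ren_sig[OF \<open>RecDecl r A M \<in> set \<Sigma>\<close>]) (rule sig)
  ultimately have rhd: "rhd (ren_sp \<pi> S2) (erase A) M (ren_tm \<pi> N)"
    using unfold_ren[of \<pi> S2 "erase A" M] by (intro unfold_imp_rhd) simp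
  have H: "\<forall>r'. ren_head \<pi> H \<noteq> Rec r'" using \<open>\<forall>r'. H \<noteq> Rec r'\<close> by (cases H) auto
  have "eq_tm \<Sigma> (map (ren_assm \<pi>) \<Delta>) (map \<pi> \<Theta>) (Neu (ren_head \<pi> H) (ren_sp \<pi> S1))
      (Neu (Rec r) (ren_sp \<pi> S2))"
    by (rule eq_tm_eq_sp.eq_unfold_right[OF \<open>RecDecl r A M \<in> set \<Sigma>\<close> _ \<open>contra M\<close> H rhd])
      (use \<open>prepat S2\<close> eq_unfold_right.IH in \<open>simp_all\<close>)
  then show ?case by simp
next
  case (eq_lam x \<Theta> M M' \<Delta>)
  have inj: "\<pi> a = \<pi> b \<longleftrightarrow> a = b" for a b using \<pi> by (simp add: bij_is_inj inj_eq)
  have "\<pi> x \<notin> fv_sig \<Sigma>" using sig eq_lam(5) inj by metis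
  moreover have "\<pi> x \<notin> (\<Union>\<delta> \<in> set (map (ren_assm \<pi>) \<Delta>). names_assm \<delta>)"
    using eq_lam(4) by (auto simp: names_ren_assm inj)
  ultimately have "eq_tm \<Sigma> (map (ren_assm \<pi>) \<Delta>) (map \<pi> \<Theta>) (Lam (ren_tm \<pi> M)) (Lam (ren_tm \<pi> M'))"
    by (intro eq_tm_eq_sp.eq_lam[of "\<pi> x"])
      (use eq_lam(1-3) eq_lam.IH in \<open>auto simp: fv_ren_tm inj ren_opn_tm\<close>)
  then show ?case by simp
qed (simp_all add: eq_con eq_var eq_nil eq_arg eq_pre)

text \<open>Swapping \<open>x\<close> with the name chosen in the derivation fixes the rest of the
  goal, as both are fresh for it. The existential choice in \<open>eq_lam\<close> may therefore be
  replaced by one particular fresh name.\<close>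

lemma eq_tm_Lam_iff:
  assumes "x \<notin> set \<Theta>" "x \<notin> fv_tm M" "x \<notin> fv_tm M'" "x \<notin> (\<Union>\<delta> \<in> set \<Delta>. names_assm \<delta>)" "x \<notin> fv_sig \<Sigma>"
  shows "eq_tm \<Sigma> \<Delta> \<Theta> (Lam M) (Lam M') \<longleftrightarrow> eq_tm \<Sigma> \<Delta> (\<Theta> @ [x]) (opn_tm 0 x M) (opn_tm 0 x M')"
proof
  assume "eq_tm \<Sigma> \<Delta> \<Theta> (Lam M) (Lam M')"
  then show "eq_tm \<Sigma> \<Delta> (\<Theta> @ [x]) (opn_tm 0 x M) (opn_tm 0 x M')"
  proof cases
    case (eq_lam y)
    define \<pi> where "\<pi> = id(x := y, y := x)"
    have "bij \<pi>" unfolding \<pi>_def by (intro involuntory_imp_bij) auto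
    have fixed: "\<pi> z = z" if "z \<noteq> x" "z \<noteq> y" for z using that by (simp add: \<pi>_def)
    have "\<pi> y = x" by (simp add: \<pi>_def)
    have "map \<pi> \<Theta> = \<Theta>" using assms(1) eq_lam(1) by (intro map_idI fixed) auto
    moreover have "map (ren_assm \<pi>) \<Delta> = \<Delta>"
      using assms(4) eq_lam(4) by (intro map_idI ren_assm_fresh fixed) auto
    moreover have "ren_tm \<pi> M = M"
      using assms(2) eq_lam(2) by (intro ren_tm_fresh fixed) auto
    moreover have "ren_tm \<pi> M' = M'"
      using assms(3) eq_lam(3) by (intro ren_tm_fresh fixed) auto
    moreover have "eq_tm \<Sigma> (map (ren_assm \<pi>) \<Delta>) (map \<pi> (\<Theta> @ [y])) (ren_tm \<pi> (opn_tm 0 y M))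
        (ren_tm \<pi> (opn_tm 0 y M'))"
      using assms(5) eq_lam(5) by (intro eq_equivariant(1)[OF \<open>bij \<pi>\<close> _ eq_lam(6)] fixed) auto
    ultimately show ?thesis using \<open>\<pi> y = x\<close> by (simp add: ren_opn_tm)
  qed auto
qed (use assms in \<open>intro eq_lam\<close>)


section \<open>Inversion of the equality judgment\<close>

definition hit :: "assm list \<Rightarrow> name list \<Rightarrow> tm \<Rightarrow> tm \<Rightarrow> bool" where
  "hit \<Delta> \<Theta> M M' \<longleftrightarrow> (\<exists>\<Theta>' H S H' S' \<sigma>. Assm \<Theta>' H S H' S' \<in> set \<Delta> \<and> renaming \<Theta> \<sigma> \<Theta>' \<and>
     M = ren_tm \<sigma> (Neu H S) \<and> M' = ren_tm \<sigma> (Neu H' S'))"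

lemma eq_tm_hit: "hit \<Delta> \<Theta> M M' \<Longrightarrow> eq_tm \<Sigma> \<Delta> \<Theta> M M'"
  unfolding hit_def by (auto intro: eq_assm simp del: ren_tm.simps)

lemma eq_tm_Lam_Neu [simp]: "\<not> eq_tm \<Sigma> \<Delta> \<Theta> (Lam M) (Neu H S)"
  and eq_tm_Neu_Lam [simp]: "\<not> eq_tm \<Sigma> \<Delta> \<Theta> (Neu H S) (Lam M)"
  by (auto elim: eq_tm.cases)

text \<open>When both heads are recursion constants there is still no choice of side, since
  \<open>eq_unfold_right\<close> demands a left head of another kind. The existential remains
  because \<open>r\<close> may have several declarations.\<close>

lemma eq_tm_Rec_left_iff:
  "eq_tm \<Sigma> \<Delta> \<Theta> (Neu (Rec r) S) (Neu H S') \<longleftrightarrow> hit \<Delta> \<Theta> (Neu (Rec r) S) (Neu H S') \<or>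
    (\<exists>A M N. RecDecl r A M \<in> set \<Sigma> \<and> contra M \<and> unfold S (erase A) M = Some N \<and>
       eq_tm \<Sigma> (\<Delta> @ [Assm \<Theta> (Rec r) S H S']) \<Theta> N (Neu H S'))"
  (is "?L \<longleftrightarrow> ?R")
proof
  assume ?L
  then show ?R
  proof cases
    case (eq_assm \<Theta>' H S1 H' S2 \<sigma>)
    then show ?thesis unfolding hit_def by fastforce
  next
    case (eq_unfold_left A M N)
    then show ?thesis using prepat_rhd_iff by blast
  qed auto
next
  assume ?R
  then show ?L using eq_tm_hit eq_unfold_left prepat_rhd_iff by blast
qed

lemma eq_tm_Rec_right_iff:
  assumes "\<And>r. H \<noteq> Rec r"
  shows "eq_tm \<Sigma> \<Delta> \<Theta> (Neu H S) (Neu (Rec r) S') \<longleftrightarrow> hit \<Delta> \<Theta> (Neu H S) (Neu (Rec r) S') \<or>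
    (\<exists>A M N. RecDecl r A M \<in> set \<Sigma> \<and> contra M \<and> unfold S' (erase A) M = Some N \<and>
       eq_tm \<Sigma> (\<Delta> @ [Assm \<Theta> H S (Rec r) S']) \<Theta> (Neu H S) N)"
  (is "?L \<longleftrightarrow> ?R")
proof
  assume ?L
  then show ?R
  proof cases
    case (eq_assm \<Theta>' H S1 H' S2 \<sigma>)
    then show ?thesis unfolding hit_def by fastforce
  next
    case (eq_unfold_right A M N)
    then show ?thesis using prepat_rhd_iff by blast
  qed (use assms in auto)
next
  assume ?R
  then show ?L using eq_tm_hit eq_unfold_right prepat_rhd_iff assms by blast
qed

lemma eq_tm_rigid_iff:
  assumes "\<And>r. H \<noteq> Rec r" "\<And>r. H' \<noteq> Rec r"
  shows "eq_tm \<Sigma> \<Delta> \<Theta> (Neu H S) (Neu H' S') \<longleftrightarrow> hit \<Delta> \<Theta> (Neu H S) (Neu H' S') \<or>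
    (H = H' \<and> (\<forall>i. H \<noteq> Var (Bound i)) \<and> eq_sp \<Sigma> \<Delta> \<Theta> S S')"
  (is "?L \<longleftrightarrow> ?R")
proof
  assume ?L
  then show ?R
  proof cases
    case (eq_assm \<Theta>' H S1 H' S2 \<sigma>)
    then show ?thesis unfolding hit_def by fastforce
  qed (use assms in auto)
next
  assume ?R
  then show ?L
  proof
    assume "H = H' \<and> (\<forall>i. H \<noteq> Var (Bound i)) \<and> eq_sp \<Sigma> \<Delta> \<Theta> S S'"
    then show ?L using assms
      by (cases H rule: head.exhaust) (auto intro: eq_con, metis eq_var var.exhaust)
  qed (rule eq_tm_hit)
qed

lemma eq_sp_simps:
  "eq_sp \<Sigma> \<Delta> \<Theta> SNil SNil"
  "\<not> eq_sp \<Sigma> \<Delta> \<Theta> SNil (SArg M S)" "\<not> eq_sp \<Sigma> \<Delta> \<Theta> SNil (SPre v S)"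
  "\<not> eq_sp \<Sigma> \<Delta> \<Theta> (SArg M S) SNil" "\<not> eq_sp \<Sigma> \<Delta> \<Theta> (SPre v S) SNil"
  "\<not> eq_sp \<Sigma> \<Delta> \<Theta> (SArg M S) (SPre v S')" "\<not> eq_sp \<Sigma> \<Delta> \<Theta> (SPre v S) (SArg M' S')"
  "eq_sp \<Sigma> \<Delta> \<Theta> (SArg M S) (SArg M' S') \<longleftrightarrow> eq_tm \<Sigma> \<Delta> \<Theta> M M' \<and> eq_sp \<Sigma> \<Delta> \<Theta> S S'"
  "eq_sp \<Sigma> \<Delta> \<Theta> (SPre v S) (SPre v' S') \<longleftrightarrow> v = v' \<and> (\<forall>i. v \<noteq> Bound i) \<and> eq_sp \<Sigma> \<Delta> \<Theta> S S'"
  by (auto elim: eq_sp.cases intro: eq_tm_eq_sp.intros) (metis eq_pre var.exhaust)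


section \<open>Termination of proof search\<close>

text \<open>\<open>Free 0\<close> serves as a blank. Bound indices are blanked as well, because
  opening turns them into names and must not change the shape.\<close>

primrec shape_head :: "head \<Rightarrow> head" where
  "shape_head (Var v) = Var (Free 0)"
| "shape_head (Con c) = Con c"
| "shape_head (Rec r) = Rec r"

primrec shape_tm :: "tm \<Rightarrow> tm" and shape_sp :: "spine \<Rightarrow> spine" where
  "shape_tm (Neu H S) = Neu (shape_head H) (shape_sp S)"
| "shape_tm (Lam M) = Lam (shape_tm M)"
| "shape_sp SNil = SNil"
| "shape_sp (SArg M S) = SArg (shape_tm M) (shape_sp S)"
| "shape_sp (SPre v S) = SPre (Free 0) (shape_sp S)"

primrec vars_head :: "head \<Rightarrow> var list" where
  "vars_head (Var v) = [v]"
| "vars_head (Con c) = []"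
| "vars_head (Rec r) = []"

primrec vars_tm :: "tm \<Rightarrow> var list" and vars_sp :: "spine \<Rightarrow> var list" where
  "vars_tm (Neu H S) = vars_head H @ vars_sp S"
| "vars_tm (Lam M) = vars_tm M"
| "vars_sp SNil = []"
| "vars_sp (SArg M S) = vars_tm M @ vars_sp S"
| "vars_sp (SPre v S) = v # vars_sp S"

lemma shape_opn_head [simp]: "shape_head (opn_head k x H) = shape_head H" by (cases H) auto
lemma shape_opn_tm [simp]: "shape_tm (opn_tm k x M) = shape_tm M"
  and shape_opn_sp [simp]: "shape_sp (opn_sp k x S) = shape_sp S"
  by (induction M and S arbitrary: k and k) auto

lemma shape_ren_head [simp]: "shape_head (ren_head f H) = shape_head H" by (cases H) auto
lemma shape_ren_tm [simp]: "shape_tm (ren_tm f M) = shape_tm M"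
  and shape_ren_sp [simp]: "shape_sp (ren_sp f S) = shape_sp S"
  by (induction M and S) auto

lemma vars_opn_head: "set (vars_head (opn_head k x H)) \<subseteq> insert (Free x) (set (vars_head H))"
proof (cases H)
  case (Var v)
  then show ?thesis by (cases v) auto
qed auto
lemma vars_opn_tm: "set (vars_tm (opn_tm k x M)) \<subseteq> insert (Free x) (set (vars_tm M))"
  and vars_opn_sp: "set (vars_sp (opn_sp k x S)) \<subseteq> insert (Free x) (set (vars_sp S))"
proof (induction M and S arbitrary: k and k)
  case (Neu H S)
  then show ?case using vars_opn_head[of k x H] by fastforce
next
  case (SArg M S)
  then show ?case by fastforce
next
  case (SPre v S)
  then show ?case using SPre.IH[of k] by (cases v) auto
qed auto

lemma vars_ren_head: "vars_head (ren_head f H) = map (ren_var f) (vars_head H)" by (cases H) auto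
lemma vars_ren_tm: "vars_tm (ren_tm f M) = map (ren_var f) (vars_tm M)"
  and vars_ren_sp: "vars_sp (ren_sp f S) = map (ren_var f) (vars_sp S)"
  by (induction M and S) (auto simp: vars_ren_head)

lemma length_vars_shape_head [simp]: "length (vars_head (shape_head H)) = length (vars_head H)"
  by (cases H) auto
lemma length_vars_shape_tm [simp]: "length (vars_tm (shape_tm M)) = length (vars_tm M)"
  and length_vars_shape_sp [simp]: "length (vars_sp (shape_sp S)) = length (vars_sp S)"
  by (induction M and S) auto

lemma length_vars_if_shape_tm: "shape_tm M = shape_tm M' \<Longrightarrow> length (vars_tm M) = length (vars_tm M')"
  by (metis length_vars_shape_tm)

lemma shape_vars_head_inj: "shape_head H = shape_head H' \<Longrightarrow> vars_head H = vars_head H' \<Longrightarrow> H = H'"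
  by (cases H; cases H') auto

lemma length_vars_if_shape_head:
  "shape_head H = shape_head H' \<Longrightarrow> length (vars_head H) = length (vars_head H')"
  by (metis length_vars_shape_head)

text \<open>A term is its shape filled in with its list of variables; equal shapes cut concatenated
  lists at the same places.\<close>

lemma shape_vars_tm_inj: "shape_tm M = shape_tm M' \<Longrightarrow> vars_tm M = vars_tm M' \<Longrightarrow> M = M'"
  and shape_vars_sp_inj: "shape_sp S = shape_sp S' \<Longrightarrow> vars_sp S = vars_sp S' \<Longrightarrow> S = S'"
proof (induction M and S arbitrary: M' and S')
  case (Neu H S)
  from Neu.prems obtain H' S' where M': "M' = Neu H' S'" by (cases M') auto
  then have sh: "shape_head H = shape_head H'" "shape_sp S = shape_sp S'" using Neu.prems by simp_all
  then have "vars_head H = vars_head H'" "vars_sp S = vars_sp S'"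
    using Neu.prems length_vars_if_shape_head[OF sh(1)] M' by simp_all
  then show ?case using Neu.IH[OF sh(2)] shape_vars_head_inj[OF sh(1)] M' by simp
next
  case (Lam M)
  from Lam.prems obtain N where "M' = Lam N" by (cases M') auto
  then show ?case using Lam.IH[of N] Lam.prems by simp
next
  case SNil
  then show ?case by (cases S') auto
next
  case (SArg M S)
  from SArg.prems obtain N T where S': "S' = SArg N T" by (cases S') auto
  then have sh: "shape_tm M = shape_tm N" "shape_sp S = shape_sp T" using SArg.prems by simp_all
  then have "vars_tm M = vars_tm N" "vars_sp S = vars_sp T"
    using SArg.prems length_vars_if_shape_tm[OF sh(1)] S' by simp_all
  then show ?case using SArg.IH(1)[OF sh(1)] SArg.IH(2)[OF sh(2)] S' by simp
next
  case (SPre v S)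
  from SPre.prems obtain w T where "S' = SPre w T" by (cases S') auto
  then show ?case using SPre.IH[of T] SPre.prems by simp
qed

text \<open>The variables outside \<open>W\<close> are compared only with each other.\<close>

definition pattern :: "var set \<Rightarrow> var list \<Rightarrow> (nat \<times> nat) set \<times> (nat \<times> var) set" where
  "pattern W vs = ({(i, j). i < length vs \<and> j < length vs \<and> vs ! i = vs ! j},
     {(i, v). i < length vs \<and> v \<in> W \<and> vs ! i = v})"

text \<open>Send a variable outside \<open>W\<close> to whatever \<open>ws\<close> has at the
  positions where \<open>vs\<close> has that variable. Equal equalities among positions make this
  well defined, and equal occurrences of \<open>W\<close> force the image outside \<open>W\<close>,
  hence into \<open>\<Theta>\<close>.\<close>

lemma pattern_eq_renaming:
  assumes len: "length vs = length ws" and pat: "pattern W vs = pattern W ws"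
    and vs: "set vs \<subseteq> W \<union> Free ` set \<Theta>'" and ws: "set ws \<subseteq> W \<union> Free ` set \<Theta>"
    and sub: "set \<Theta>' \<subseteq> set \<Theta>"
  shows "\<exists>\<sigma>. renaming \<Theta> \<sigma> \<Theta>' \<and> map (ren_var \<sigma>) vs = ws"
proof -
  have E: "vs ! i = vs ! j \<longleftrightarrow> ws ! i = ws ! j" if "i < length vs" "j < length vs" for i j
  proof -
    have "(i, j) \<in> fst (pattern W vs) \<longleftrightarrow> (i, j) \<in> fst (pattern W ws)" using pat by simp
    then show ?thesis using that len by (simp add: pattern_def)
  qed
  have O: "vs ! i = v \<longleftrightarrow> ws ! i = v" if "i < length vs" "v \<in> W" for i v
  proof -
    have "(i, v) \<in> snd (pattern W vs) \<longleftrightarrow> (i, v) \<in> snd (pattern W ws)" using pat by simp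
    then show ?thesis using that len by (simp add: pattern_def)
  qed
  define new where "new x i \<longleftrightarrow> i < length vs \<and> vs ! i = Free x \<and> Free x \<notin> W" for x i
  define \<sigma> where "\<sigma> x = (if \<exists>i. new x i then (THE y. \<forall>i. new x i \<longrightarrow> ws ! i = Free y) else x)" for x
  have new: "ws ! i = Free (\<sigma> x) \<and> \<sigma> x \<in> set \<Theta> \<and> x \<in> set \<Theta>'" if "new x i" for x i
  proof -
    have i: "i < length vs" "vs ! i = Free x" "Free x \<notin> W" using that by (auto simp: new_def)
    have "ws ! i \<notin> W" using O[OF i(1), of "ws ! i"] i by auto
    moreover have "ws ! i \<in> W \<union> Free ` set \<Theta>" using i(1) len by (intro subsetD[OF ws]) simp
    ultimately obtain y where y: "ws ! i = Free y" "y \<in> set \<Theta>" by auto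
    have "ws ! j = Free y" if "new x j" for j
      using E[of i j] i that y unfolding new_def by simp
    then have "(THE y. \<forall>i. new x i \<longrightarrow> ws ! i = Free y) = y"
      using that y(1) by (intro the_equality) auto
    moreover have "x \<in> set \<Theta>'" using subsetD[OF vs nth_mem[OF i(1)]] i by auto
    ultimately show ?thesis using that y unfolding \<sigma>_def by auto
  qed
  have old: "\<sigma> x = x" if "\<And>i. \<not> new x i" for x using that by (simp add: \<sigma>_def)
  have "renaming \<Theta> \<sigma> \<Theta>'"
    unfolding renaming_def
  proof (intro conjI ballI allI impI)
    \<comment> \<open>A variable of \<open>\<Theta>'\<close> that belongs to \<open>W\<close> or
      does not occur in \<open>vs\<close> stays where it is; only \<open>sub\<close> places it in
      \<open>\<Theta>\<close>.\<close>
    fix x assume "x \<in> set \<Theta>'"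
    then show "\<sigma> x \<in> set \<Theta>" using new[of x] old[of x] sub by (cases "\<exists>i. new x i") auto
  next
    fix x assume "x \<notin> set \<Theta>'"
    then show "\<sigma> x = x" using new[of x] old[of x] by blast
  qed
  moreover have "map (ren_var \<sigma>) vs = ws"
  proof (rule nth_equalityI)
    fix i assume i: "i < length (map (ren_var \<sigma>) vs)"
    show "map (ren_var \<sigma>) vs ! i = ws ! i"
    proof (cases "vs ! i \<in> W")
      case True
      then have "ren_var \<sigma> (vs ! i) = vs ! i"
        by (cases "vs ! i") (auto intro: old simp: new_def)
      then show ?thesis using O[of i "vs ! i"] True i by simp
    next
      case False
      moreover have "vs ! i \<in> W \<union> Free ` set \<Theta>'" using i by (intro subsetD[OF vs]) simp
      ultimately obtain x where "vs ! i = Free x" by auto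
      then show ?thesis using new[of x i] False i by (simp add: new_def)
    qed
  qed (simp add: len)
  ultimately show ?thesis by blast
qed

text \<open>Joining the two variable lists makes the pattern record variables shared between the
  sides, so that one renaming serves both.\<close>

definition goal_class :: "var set \<Rightarrow> tm \<Rightarrow> tm \<Rightarrow> tm \<times> tm \<times> (nat \<times> nat) set \<times> (nat \<times> var) set" where
  "goal_class W M M' = (shape_tm M, shape_tm M', pattern W (vars_tm M @ vars_tm M'))"

text \<open>A finite set large enough for all goals of a search: bounded codes leave finitely many
  shapes, and a pattern consists of a relation on positions and a relation between positions and
  \<open>W\<close>.\<close>

definition classes :: "nat \<Rightarrow> var set \<Rightarrow> (tm \<times> tm \<times> (nat \<times> nat) set \<times> (nat \<times> var) set) set" where
  "classes b W = (SIGMA s : {s. enc_tm s \<le> b}. SIGMA s' : {s. enc_tm s \<le> b}.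
     let I = {..<length (vars_tm s) + length (vars_tm s')} in Pow (I \<times> I) \<times> Pow (I \<times> W))"

text \<open>Contexts only grow along a branch, so assumptions recorded there meet the condition
  \<open>set \<Theta>' \<subseteq> set \<Theta>\<close>, which \<open>pattern_eq_renaming\<close>
  requires.\<close>

definition covered :: "var set \<Rightarrow> assm list \<Rightarrow> name list \<Rightarrow>
    (tm \<times> tm \<times> (nat \<times> nat) set \<times> (nat \<times> var) set) set" where
  "covered W \<Delta> \<Theta> = {goal_class W (Neu H S) (Neu H' S') | \<Theta>' H S H' S'.
     Assm \<Theta>' H S H' S' \<in> set \<Delta> \<and> set \<Theta>' \<subseteq> set \<Theta> \<and>
     set (vars_tm (Neu H S)) \<union> set (vars_tm (Neu H' S')) \<subseteq> W \<union> Free ` set \<Theta>'}"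

definition uncovered :: "nat \<Rightarrow> var set \<Rightarrow> assm list \<Rightarrow> name list \<Rightarrow> nat" where
  "uncovered b W \<Delta> \<Theta> = card (classes b W - covered W \<Delta> \<Theta>)"

definition bounded_tm :: "nat \<Rightarrow> var set \<Rightarrow> name list \<Rightarrow> tm \<Rightarrow> bool" where
  "bounded_tm b W \<Theta> M \<longleftrightarrow> enc_tm (shape_tm M) \<le> b \<and> set (vars_tm M) \<subseteq> W \<union> Free ` set \<Theta>"

definition bounded_sp :: "nat \<Rightarrow> var set \<Rightarrow> name list \<Rightarrow> spine \<Rightarrow> bool" where
  "bounded_sp b W \<Theta> S \<longleftrightarrow> enc_sp (shape_sp S) \<le> b \<and> set (vars_sp S) \<subseteq> W \<union> Free ` set \<Theta>"

lemma finite_classes: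
  assumes "finite W"
  shows "finite (classes b W)"
proof -
  have "finite {s. enc_tm s \<le> b}"
    by (rule finite_imageD[of enc_tm])
      (auto intro: finite_subset[of _ "{..b}"] simp: inj_on_def enc_tm_inj)
  then show ?thesis unfolding classes_def using assms by (intro finite_SigmaI) (auto simp: Let_def)
qed

lemma goal_class_in_classes:
  assumes "bounded_tm b W \<Theta> M" "bounded_tm b W \<Theta> M'"
  shows "goal_class W M M' \<in> classes b W"
  using assms by (auto simp: goal_class_def classes_def bounded_tm_def pattern_def Let_def)

text \<open>Equal patterns provide a renaming between the variable lists, and equal shapes lift it
  to the terms themselves.\<close>

lemma hit_if_covered:
  assumes "bounded_tm b W \<Theta> M" "bounded_tm b W \<Theta> M'" "goal_class W M M' \<in> covered W \<Delta> \<Theta>"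
  shows "hit \<Delta> \<Theta> M M'"
proof -
  obtain \<Theta>' H S H' S' where *: "Assm \<Theta>' H S H' S' \<in> set \<Delta>" "set \<Theta>' \<subseteq> set \<Theta>"
    "set (vars_tm (Neu H S)) \<union> set (vars_tm (Neu H' S')) \<subseteq> W \<union> Free ` set \<Theta>'"
    "goal_class W M M' = goal_class W (Neu H S) (Neu H' S')"
    using assms(3) unfolding covered_def by auto
  let ?N = "Neu H S" and ?N' = "Neu H' S'"
  have sh: "shape_tm M = shape_tm ?N" "shape_tm M' = shape_tm ?N'"
    and pat: "pattern W (vars_tm ?N @ vars_tm ?N') = pattern W (vars_tm M @ vars_tm M')"
    using *(4) unfolding goal_class_def by simp_all
  note len = length_vars_if_shape_tm[OF sh(1)] length_vars_if_shape_tm[OF sh(2)]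
  obtain \<sigma> where \<sigma>: "renaming \<Theta> \<sigma> \<Theta>'"
    "map (ren_var \<sigma>) (vars_tm ?N @ vars_tm ?N') = vars_tm M @ vars_tm M'"
    using pattern_eq_renaming[OF _ pat, of \<Theta>' \<Theta>] *(2,3) len assms(1,2)
    by (auto simp: bounded_tm_def)
  then have "vars_tm (ren_tm \<sigma> ?N) = vars_tm M" "vars_tm (ren_tm \<sigma> ?N') = vars_tm M'"
    using len by (auto simp: vars_ren_tm simp del: vars_tm.simps ren_tm.simps)
  then have "M = ren_tm \<sigma> ?N" "M' = ren_tm \<sigma> ?N'"
    using sh shape_vars_tm_inj[of M "ren_tm \<sigma> ?N"] shape_vars_tm_inj[of M' "ren_tm \<sigma> ?N'"]
    by (simp_all del: ren_tm.simps shape_tm.simps vars_tm.simps)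
  then show ?thesis unfolding hit_def using *(1) \<sigma>(1) by blast
qed

lemma covered_mono:
  assumes "set \<Delta> \<subseteq> set \<Delta>'" "set \<Theta> \<subseteq> set \<Theta>'"
  shows "covered W \<Delta> \<Theta> \<subseteq> covered W \<Delta>' \<Theta>'"
  using assms unfolding covered_def by blast

lemma uncovered_mono:
  assumes "finite W" "set \<Delta> \<subseteq> set \<Delta>'" "set \<Theta> \<subseteq> set \<Theta>'"
  shows "uncovered b W \<Delta>' \<Theta>' \<le> uncovered b W \<Delta> \<Theta>"
proof -
  have "classes b W - covered W \<Delta>' \<Theta>' \<subseteq> classes b W - covered W \<Delta> \<Theta>"
    using covered_mono[OF assms(2,3)] by blast
  then show ?thesis unfolding uncovered_def using finite_classes[OF assms(1)]
    by (intro card_mono) auto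
qed

text \<open>Without a hit the class of the goal cannot be covered yet; the recorded assumption,
  whose context is \<open>\<Theta>\<close> itself, covers it.\<close>

lemma uncovered_less:
  assumes "finite W" "bounded_tm b W \<Theta> (Neu H S)" "bounded_tm b W \<Theta> (Neu H' S')"
    and "\<not> hit \<Delta> \<Theta> (Neu H S) (Neu H' S')"
  shows "uncovered b W (\<Delta> @ [Assm \<Theta> H S H' S']) \<Theta> < uncovered b W \<Delta> \<Theta>"
proof -
  let ?\<Delta> = "\<Delta> @ [Assm \<Theta> H S H' S']" and ?c = "goal_class W (Neu H S) (Neu H' S')"
  have "?c \<in> classes b W" by (rule goal_class_in_classes[OF assms(2,3)])
  moreover have "?c \<notin> covered W \<Delta> \<Theta>" using hit_if_covered[OF assms(2,3)] assms(4) by blast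
  moreover have "?c \<in> covered W ?\<Delta> \<Theta>"
    using assms(2,3) unfolding covered_def bounded_tm_def
    by (intro CollectI exI[of _ \<Theta>] exI[of _ H] exI[of _ S] exI[of _ H'] exI[of _ S']) auto
  moreover have "covered W \<Delta> \<Theta> \<subseteq> covered W ?\<Delta> \<Theta>" by (rule covered_mono) auto
  ultimately have "classes b W - covered W ?\<Delta> \<Theta> \<subset> classes b W - covered W \<Delta> \<Theta>" by blast
  then show ?thesis
    unfolding uncovered_def using finite_classes[OF assms(1)] by (intro psubset_card_mono) auto
qed

section \<open>Bounds on codes and variables that the steps of the search preserve\<close>

lemma enc_sp_less_enc_tm: "enc_sp S < enc_tm (Neu H S)"
  and enc_tm_less_enc_tm: "enc_tm M < enc_tm (Lam M)"
  and enc_tm_less_enc_sp: "enc_tm M < enc_sp (SArg M S)"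
  and enc_sp_less_enc_sp: "enc_sp S < enc_sp (SArg M S)" "enc_sp S < enc_sp (SPre v S)"
  by (auto intro!: list_encode_greater)

lemma bounded_tm_opn:
  assumes "bounded_tm b W \<Theta> (Lam M)"
  shows "bounded_tm b W (\<Theta> @ [x]) (opn_tm 0 x M)"
  using assms enc_tm_less_enc_tm[of "shape_tm M"] vars_opn_tm[of 0 x M]
  by (auto simp: bounded_tm_def simp del: enc_tm.simps)

lemma bounded_Neu: "bounded_tm b W \<Theta> (Neu H S) \<Longrightarrow> bounded_sp b W \<Theta> S"
  using enc_sp_less_enc_tm[of "shape_sp S" "shape_head H"]
  by (auto simp: bounded_tm_def bounded_sp_def simp del: enc_tm.simps)

lemma bounded_SArg: "bounded_sp b W \<Theta> (SArg M S) \<Longrightarrow> bounded_tm b W \<Theta> M \<and> bounded_sp b W \<Theta> S"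
  using enc_tm_less_enc_sp[of "shape_tm M" "shape_sp S"]
    enc_sp_less_enc_sp(1)[of "shape_sp S" "shape_tm M"]
  by (auto simp: bounded_tm_def bounded_sp_def simp del: enc_sp.simps)

lemma bounded_SPre: "bounded_sp b W \<Theta> (SPre v S) \<Longrightarrow> bounded_sp b W \<Theta> S"
  using enc_sp_less_enc_sp(2)[of "shape_sp S" "Free 0"]
  by (auto simp: bounded_sp_def simp del: enc_sp.simps)

text \<open>Stripping an abstraction lowers the code of the shape, while putting a variable of the
  spine for the index leaves the shape alone.\<close>

lemma unfold_shape_vars:
  "unfold S \<tau> M = Some N \<Longrightarrow>
   enc_tm (shape_tm N) \<le> enc_tm (shape_tm M) \<and> set (vars_tm N) \<subseteq> set (vars_tm M) \<union> set (vars_sp S)"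
proof (induction S arbitrary: \<tau> M rule: spine_induct)
  case (SPre v S)
  then obtain y \<tau>' M' where *: "v = Free y" "M = Lam M'" "unfold S \<tau>' (opn_tm 0 y M') = Some N"
    by (auto split: var.splits sty.splits tm.splits)
  show ?case
    using SPre.IH[OF *(3)] *(1,2) vars_opn_tm[of 0 y M'] enc_tm_less_enc_tm[of "shape_tm M'"]
    by (auto simp del: enc_tm.simps)
qed (auto split: sty.splits tm.splits)

lemma bounded_unfold:
  assumes "unfold S \<tau> M = Some N" "bounded_tm b W \<Theta> (Neu H S)"
    and "enc_tm (shape_tm M) \<le> b" "set (vars_tm M) \<subseteq> W"
  shows "bounded_tm b W \<Theta> N"
  using unfold_shape_vars[OF assms(1)] assms(2-4) unfolding bounded_tm_def
  by (auto simp del: enc_tm.simps)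


section \<open>The decision program\<close>

declare list_encode_Nil [simp]

lemma list_encode_pos [simp]: "0 < list_encode xs \<longleftrightarrow> xs \<noteq> []" and consc_pos [simp]: "0 < consc a b"
  using list_encode_eq_0[of xs] consc_neq_0[of a b] by linarith+

definition nthc :: "nat \<Rightarrow> nat \<Rightarrow> nat" where "nthc j n = hdc ((tlc ^^ j) n)"

lemma nthc_list_encode [simp]: "j < length xs \<Longrightarrow> nthc j (list_encode xs) = xs ! j"
  by (simp add: nthc_def tlc_funpow Cons_nth_drop_Suc[symmetric])

lemma nthc_0 [simp]: "nthc 0 n = hdc n"
  by (simp add: nthc_def)

lemma nthc_Suc: "nthc (Suc j) n = nthc j (tlc n)"
  by (simp add: nthc_def funpow_swap1)

lemma nthc_of_0: "nthc j 0 = 0"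
  by (induction j) (simp_all add: nthc_Suc)

lemma nthc_less: "n \<noteq> 0 \<Longrightarrow> nthc j n < n"
proof (induction j arbitrary: n)
  case 0
  then show ?case by (simp add: hdc_less)
next
  case (Suc j)
  show ?case
  proof (cases "tlc n = 0")
    case False
    then show ?thesis using Suc.IH[OF False] tlc_less[OF Suc.prems] by (simp add: nthc_Suc)
  qed (use Suc.prems in \<open>simp add: nthc_Suc nthc_of_0\<close>)
qed

lemma consc_0 [simp]: "consc x 0 = list_encode [x]"
  by (simp add: list_encode_Cons list_encode_Nil del: consc_list_encode)

definition efield :: "nat \<Rightarrow> exp \<Rightarrow> exp" where "efield j e = EHd ((ETl ^^ j) e)"

lemma evalx_efield [simp]:
  "evalx \<phi> (efield j e) a = Option.bind (evalx \<phi> e a) (\<lambda>x. Some (nthc j x))"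
proof -
  have "evalx \<phi> ((ETl ^^ j) e) a = Option.bind (evalx \<phi> e a) (\<lambda>x. Some ((tlc ^^ j) x))"
    by (induction j) (cases "evalx \<phi> e a"; simp)+
  then show ?thesis by (cases "evalx \<phi> e a") (simp_all add: efield_def nthc_def)
qed

primrec elist :: "exp list \<Rightarrow> exp" where
  "elist [] = EConst 0"
| "elist (e # es) = ECons e (elist es)"

abbreviation "ecall f es \<equiv> ECall (elist (EConst f # es))"
abbreviation "eand e1 e2 \<equiv> EIf e1 e2 (EConst 0)"
abbreviation "eor e1 e2 \<equiv> EIf e1 (EConst 1) e2"
abbreviation "enot e \<equiv> EIf e (EConst 0) (EConst 1)"
abbreviation "etag e n \<equiv> EEq (efield 0 e) (EConst n)"
abbreviation "earg i \<equiv> efield i EArg"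

text \<open>
  An argument of the program is a list \<open>f # args\<close>; the tag \<open>f\<close> selects one of the functions below,
  and \<open>earg i\<close> is its \<open>i\<close>-th argument, counting from \<open>1\<close>.
\<close>

abbreviation (input) "MAIN \<equiv> 0 :: nat"
abbreviation (input) "NORM_TM \<equiv> 1 :: nat"
abbreviation (input) "NORM_SP \<equiv> 2 :: nat"
abbreviation (input) "NORM_ASSMS \<equiv> 3 :: nat"
abbreviation (input) "OPN_TM \<equiv> 4 :: nat"
abbreviation (input) "OPN_SP \<equiv> 5 :: nat"
abbreviation (input) "LOOKUP \<equiv> 6 :: nat"
abbreviation (input) "REN_TM \<equiv> 7 :: nat"
abbreviation (input) "REN_SP \<equiv> 8 :: nat"
abbreviation (input) "MATCH \<equiv> 9 :: nat"
abbreviation (input) "MATCH_ANY \<equiv> 10 :: nat"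
abbreviation (input) "HIT \<equiv> 11 :: nat"
abbreviation (input) "UNFOLD \<equiv> 12 :: nat"
abbreviation (input) "SNOC \<equiv> 13 :: nat"
abbreviation (input) "EQ_TM \<equiv> 14 :: nat"
abbreviation (input) "EQ_SP \<equiv> 15 :: nat"
abbreviation (input) "TRY \<equiv> 16 :: nat"

text \<open>Every nonzero tag is read as 1, so any number yields the code of some variable. The
  other \<open>norm\<close> programs follow the same plan: total on numbers, identity on genuine
  codes.\<close>

definition norm_var :: "exp \<Rightarrow> exp" where
  "norm_var e = elist [EIf (efield 0 e) (EConst 1) (EConst 0), efield 1 e]"

definition norm_head :: "exp \<Rightarrow> exp" where
  "norm_head e =
     EIf (etag e 0) (elist [EConst 0, norm_var (efield 1 e)])
    (EIf (etag e 1) (elist [EConst 1, efield 1 e])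
    (elist [EConst 2, efield 1 e]))"

definition norm_tm_body :: exp where
  "norm_tm_body = (let n = earg 1 in
     EIf (efield 0 n) (elist [EConst 1, ecall NORM_TM [efield 1 n]])
    (elist [EConst 0, norm_head (efield 1 n), ecall NORM_SP [efield 2 n]]))"

definition norm_sp_body :: exp where
  "norm_sp_body = (let n = earg 1 in
     EIf (etag n 1) (elist [EConst 1, ecall NORM_TM [efield 1 n], ecall NORM_SP [efield 2 n]])
    (EIf (etag n 2) (elist [EConst 2, norm_var (efield 1 n), ecall NORM_SP [efield 2 n]])
    (elist [EConst 0])))"

definition norm_assms_body :: exp where
  "norm_assms_body = (let n = earg 1; h = EHd n in
     eand n (ECons
       (elist [efield 0 h, norm_head (efield 1 h), ecall NORM_SP [efield 2 h],
          norm_head (efield 3 h), ecall NORM_SP [efield 4 h]])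
       (ecall NORM_ASSMS [ETl n])))"

definition main_body :: exp where
  "main_body = (let n = earg 1 in
     ecall EQ_TM [ecall NORM_ASSMS [efield 0 n], efield 1 n,
       ecall NORM_TM [efield 2 n], ecall NORM_TM [efield 3 n]])"

definition opn_var_exp :: "exp \<Rightarrow> exp" where
  "opn_var_exp v =
     EIf (efield 0 v) (EIf (EEq (efield 1 v) (earg 1)) (elist [EConst 0, earg 2]) v) v"

definition opn_tm_body :: exp where
  "opn_tm_body = (let k = earg 1; x = earg 2; M = earg 3; H = efield 1 M in
     EIf (efield 0 M) (elist [EConst 1, ecall OPN_TM [ESuc k, x, efield 1 M]])
    (elist [EConst 0, EIf (efield 0 H) H (elist [EConst 0, opn_var_exp (efield 1 H)]),
       ecall OPN_SP [k, x, efield 2 M]]))"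

definition opn_sp_body :: exp where
  "opn_sp_body = (let k = earg 1; x = earg 2; S = earg 3 in
     EIf (etag S 1) (elist [EConst 1, ecall OPN_TM [k, x, efield 1 S], ecall OPN_SP [k, x, efield 2 S]])
    (EIf (etag S 2) (elist [EConst 2, opn_var_exp (efield 1 S), ecall OPN_SP [k, x, efield 2 S]])
    S))"

definition lookup_body :: exp where
  "lookup_body = (let \<sigma> = earg 1; x = earg 2 in
     EIf \<sigma> (EIf (EEq (efield 0 (EHd \<sigma>)) x) (efield 1 (EHd \<sigma>)) (ecall LOOKUP [ETl \<sigma>, x])) x)"

definition ren_var_exp :: "exp \<Rightarrow> exp" where
  "ren_var_exp v = EIf (efield 0 v) v (elist [EConst 0, ecall LOOKUP [earg 1, efield 1 v]])"

definition ren_tm_body :: exp where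
  "ren_tm_body = (let \<sigma> = earg 1; M = earg 2; H = efield 1 M in
     EIf (efield 0 M) (elist [EConst 1, ecall REN_TM [\<sigma>, efield 1 M]])
    (elist [EConst 0, EIf (efield 0 H) H (elist [EConst 0, ren_var_exp (efield 1 H)]),
       ecall REN_SP [\<sigma>, efield 2 M]]))"

definition ren_sp_body :: exp where
  "ren_sp_body = (let \<sigma> = earg 1; S = earg 2 in
     EIf (etag S 1) (elist [EConst 1, ecall REN_TM [\<sigma>, efield 1 S], ecall REN_SP [\<sigma>, efield 2 S]])
    (EIf (etag S 2) (elist [EConst 2, ren_var_exp (efield 1 S), ecall REN_SP [\<sigma>, efield 2 S]])
    S))"

text \<open>\<open>MATCH\<close> and \<open>MATCH_ANY\<close> search through all maps from \<open>\<Theta>'\<close> to \<open>\<Theta>\<close>, as association lists.\<close>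

definition match_body :: exp where
  "match_body = (let \<Theta>' = earg 1; \<Theta> = earg 2; \<sigma> = earg 3; N = earg 4; N' = earg 5; M = earg 6; M' = earg 7 in
     EIf \<Theta>' (ecall MATCH_ANY [\<Theta>, EHd \<Theta>', ETl \<Theta>', \<Theta>, \<sigma>, N, N', M, M'])
    (eand (EEq (ecall REN_TM [\<sigma>, N]) M) (EEq (ecall REN_TM [\<sigma>, N']) M')))"

definition match_any_body :: exp where
  "match_any_body = (let ys = earg 1; x = earg 2; \<Theta>' = earg 3; \<Theta> = earg 4; \<sigma> = earg 5;
       N = earg 6; N' = earg 7; M = earg 8; M' = earg 9 in
     eand ys (eor (ecall MATCH [\<Theta>', \<Theta>, ECons (elist [x, EHd ys]) \<sigma>, N, N', M, M'])
       (ecall MATCH_ANY [ETl ys, x, \<Theta>', \<Theta>, \<sigma>, N, N', M, M'])))"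

definition hit_body :: exp where
  "hit_body = (let \<Delta> = earg 1; \<Theta> = earg 2; M = earg 3; M' = earg 4; \<delta> = EHd \<Delta> in
     eand \<Delta> (eor
       (ecall MATCH [efield 0 \<delta>, \<Theta>, EConst 0, elist [EConst 0, efield 1 \<delta>, efield 2 \<delta>],
          elist [EConst 0, efield 3 \<delta>, efield 4 \<delta>], M, M'])
       (ecall HIT [ETl \<Delta>, \<Theta>, M, M'])))"

text \<open>Failure is 0 and success a one-element list, so the caller can test the result as a
  truth value and take its head.\<close>

definition unfold_body :: exp where
  "unfold_body = (let S = earg 1; \<tau> = earg 2; M = earg 3; v = efield 1 S in
     EIf (etag S 2)
       (eand \<tau> (eand (enot (efield 0 \<tau>)) (eand (efield 0 M) (eand (enot (efield 0 v))
         (ecall UNFOLD [efield 2 S, ETl \<tau>, ecall OPN_TM [EConst 0, efield 1 v, efield 1 M]])))))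
    (eand (enot (efield 0 S)) (eand (enot \<tau>) (eand (enot (efield 0 M)) (elist [M])))))"

definition snoc_body :: exp where
  "snoc_body = (let xs = earg 1; x = earg 2 in
     EIf xs (ECons (EHd xs) (ecall SNOC [ETl xs, x])) (elist [x]))"

text \<open>All that \<open>unfold\<close> asks of a domain type is whether it is
  \<open>Base\<close>, so one bit per argument is stored; \<open>Base\<close> as nil marks the
  end.\<close>

primrec enc_sty :: "sty \<Rightarrow> nat" where
  "enc_sty Base = 0"
| "enc_sty (Arr \<tau> \<tau>') = consc (if \<tau> = Base then 0 else 1) (enc_sty \<tau>')"

definition enc_entry :: "name \<times> sty \<times> tm \<Rightarrow> nat" where
  "enc_entry = (\<lambda>(r, \<tau>, M). list_encode [r, enc_sty \<tau>, enc_tm M])"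

text \<open>Contractiveness and erasure depend on \<open>\<Sigma>\<close> alone. They are settled
  here, and the finished table enters the program as a constant.\<close>

definition rec_table :: "sig \<Rightarrow> (name \<times> sty \<times> tm) list" where
  "rec_table \<Sigma> = concat (map (\<lambda>d. case d of RecDecl r A M \<Rightarrow> if contra M then [(r, erase A, M)] else []
     | _ \<Rightarrow> []) \<Sigma>)"

text \<open>
  The fresh name in the case of two abstractions is the code of a list that contains \<open>Max (fv_sig \<Sigma>)\<close>
  and the whole goal; it exceeds every name in them.
\<close>

definition eq_tm_body :: "sig \<Rightarrow> exp" where
  "eq_tm_body \<Sigma> = (let \<Delta> = earg 1; \<Theta> = earg 2; M = earg 3; M' = earg 4;
       H = efield 1 M; S = efield 2 M; H' = efield 1 M'; S' = efield 2 M';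
       \<Delta>' = ecall SNOC [\<Delta>, elist [\<Theta>, H, S, H', S']];
       T = EConst (list_encode (map enc_entry (rec_table \<Sigma>)));
       x = elist [EConst (Max (insert 0 (fv_sig \<Sigma>))), \<Delta>, \<Theta>, M, M'] in
     EIf (efield 0 M)
       (eand (efield 0 M') (ecall EQ_TM [\<Delta>, ecall SNOC [\<Theta>, x],
          ecall OPN_TM [EConst 0, x, efield 1 M], ecall OPN_TM [EConst 0, x, efield 1 M']]))
    (eand (enot (efield 0 M')) (eor (ecall HIT [\<Delta>, \<Theta>, M, M'])
      (EIf (etag H 2) (ecall TRY [T, efield 1 H, S, \<Delta>', \<Theta>, M', EConst 0])
      (EIf (etag H' 2) (ecall TRY [T, efield 1 H', S', \<Delta>', \<Theta>, M, EConst 1])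
      (eand (EEq H H') (eand (eor (efield 0 H) (enot (efield 0 (efield 1 H))))
         (ecall EQ_SP [\<Delta>, \<Theta>, S, S']))))))))"

definition eq_sp_body :: exp where
  "eq_sp_body = (let \<Delta> = earg 1; \<Theta> = earg 2; S = earg 3; S' = earg 4 in
     eand (EEq (efield 0 S) (efield 0 S'))
    (EIf (etag S 0) (EConst 1)
    (EIf (etag S 1) (eand (ecall EQ_TM [\<Delta>, \<Theta>, efield 1 S, efield 1 S'])
       (ecall EQ_SP [\<Delta>, \<Theta>, efield 2 S, efield 2 S']))
    (eand (EEq (efield 1 S) (efield 1 S')) (eand (enot (efield 0 (efield 1 S)))
       (ecall EQ_SP [\<Delta>, \<Theta>, efield 2 S, efield 2 S']))))))"

definition try_body :: exp where
  "try_body = (let T = earg 1; r = earg 2; S = earg 3; \<Delta> = earg 4; \<Theta> = earg 5; M = earg 6; right = earg 7;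
       U = ecall UNFOLD [S, efield 1 (EHd T), efield 2 (EHd T)] in
     eand T (eor
       (eand (EEq (efield 0 (EHd T)) r) (eand U
         (EIf right (ecall EQ_TM [\<Delta>, \<Theta>, M, EHd U]) (ecall EQ_TM [\<Delta>, \<Theta>, EHd U, M]))))
       (ecall TRY [ETl T, r, S, \<Delta>, \<Theta>, M, right])))"

text \<open>The position of a body in this list is the tag that selects it.\<close>

definition function_bodies :: "sig \<Rightarrow> exp list" where
  "function_bodies \<Sigma> = [main_body, norm_tm_body, norm_sp_body, norm_assms_body, opn_tm_body, opn_sp_body,
     lookup_body, ren_tm_body, ren_sp_body, match_body, match_any_body, hit_body, unfold_body,
     snoc_body, eq_tm_body \<Sigma>, eq_sp_body, try_body]"

primrec dispatch :: "nat \<Rightarrow> exp list \<Rightarrow> exp" where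
  "dispatch n [] = EConst 0"
| "dispatch n (e # es) = EIf (EEq (EHd EArg) (EConst n)) e (dispatch (Suc n) es)"

definition run :: "sig \<Rightarrow> nat list \<Rightarrow> nat option" where
  "run \<Sigma> xs = sem (dispatch 0 (function_bodies \<Sigma>)) (list_encode xs)"

definition evalr :: "sig \<Rightarrow> exp \<Rightarrow> nat list \<Rightarrow> nat option" where
  "evalr \<Sigma> e xs = evalx (sem (dispatch 0 (function_bodies \<Sigma>))) e (list_encode xs)"

lemma evalx_dispatch:
  "i < length es \<Longrightarrow> hdc a = n + i \<Longrightarrow> evalx \<phi> (dispatch n es) a = evalx \<phi> (es ! i) a"
proof (induction es arbitrary: n i)
  case (Cons e es)
  then show ?case by (cases i) auto
qed simp

lemma run_unfold: "f < length (function_bodies \<Sigma>) \<Longrightarrow> run \<Sigma> (f # xs) = evalr \<Sigma> (function_bodies \<Sigma> ! f) (f # xs)"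
  unfolding run_def evalr_def by (subst sem_unfold) (simp add: evalx_dispatch)

lemma run_simps:
  "run \<Sigma> (MAIN # xs) = evalr \<Sigma> main_body (MAIN # xs)"
  "run \<Sigma> (NORM_TM # xs) = evalr \<Sigma> norm_tm_body (NORM_TM # xs)"
  "run \<Sigma> (NORM_SP # xs) = evalr \<Sigma> norm_sp_body (NORM_SP # xs)"
  "run \<Sigma> (NORM_ASSMS # xs) = evalr \<Sigma> norm_assms_body (NORM_ASSMS # xs)"
  "run \<Sigma> (OPN_TM # xs) = evalr \<Sigma> opn_tm_body (OPN_TM # xs)"
  "run \<Sigma> (OPN_SP # xs) = evalr \<Sigma> opn_sp_body (OPN_SP # xs)"
  "run \<Sigma> (LOOKUP # xs) = evalr \<Sigma> lookup_body (LOOKUP # xs)"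
  "run \<Sigma> (REN_TM # xs) = evalr \<Sigma> ren_tm_body (REN_TM # xs)"
  "run \<Sigma> (REN_SP # xs) = evalr \<Sigma> ren_sp_body (REN_SP # xs)"
  "run \<Sigma> (MATCH # xs) = evalr \<Sigma> match_body (MATCH # xs)"
  "run \<Sigma> (MATCH_ANY # xs) = evalr \<Sigma> match_any_body (MATCH_ANY # xs)"
  "run \<Sigma> (HIT # xs) = evalr \<Sigma> hit_body (HIT # xs)"
  "run \<Sigma> (UNFOLD # xs) = evalr \<Sigma> unfold_body (UNFOLD # xs)"
  "run \<Sigma> (SNOC # xs) = evalr \<Sigma> snoc_body (SNOC # xs)"
  "run \<Sigma> (EQ_TM # xs) = evalr \<Sigma> (eq_tm_body \<Sigma>) (EQ_TM # xs)"
  "run \<Sigma> (EQ_SP # xs) = evalr \<Sigma> eq_sp_body (EQ_SP # xs)"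
  "run \<Sigma> (TRY # xs) = evalr \<Sigma> try_body (TRY # xs)"
  by (subst run_unfold; simp add: function_bodies_def)+

lemma evalr_simps [simp]:
  "evalr \<Sigma> EArg xs = Some (list_encode xs)"
  "evalr \<Sigma> (EConst c) xs = Some c"
  "evalr \<Sigma> (ECons e1 e2) xs =
     Option.bind (evalr \<Sigma> e1 xs) (\<lambda>x. Option.bind (evalr \<Sigma> e2 xs) (\<lambda>y. Some (consc x y)))"
  "evalr \<Sigma> (EHd e) xs = Option.bind (evalr \<Sigma> e xs) (\<lambda>x. Some (hdc x))"
  "evalr \<Sigma> (ETl e) xs = Option.bind (evalr \<Sigma> e xs) (\<lambda>x. Some (tlc x))"
  "evalr \<Sigma> (ESuc e) xs = Option.bind (evalr \<Sigma> e xs) (\<lambda>x. Some (Suc x))"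
  "evalr \<Sigma> (EEq e1 e2) xs =
     Option.bind (evalr \<Sigma> e1 xs) (\<lambda>x. Option.bind (evalr \<Sigma> e2 xs) (\<lambda>y. Some (of_bool (x = y))))"
  "evalr \<Sigma> (EIf e1 e2 e3) xs =
     Option.bind (evalr \<Sigma> e1 xs) (\<lambda>x. if x \<noteq> 0 then evalr \<Sigma> e2 xs else evalr \<Sigma> e3 xs)"
  "evalr \<Sigma> (ECall e) xs = Option.bind (evalr \<Sigma> e xs) (\<lambda>x. run \<Sigma> (list_decode x))"
  "evalr \<Sigma> (efield j e) xs = Option.bind (evalr \<Sigma> e xs) (\<lambda>x. Some (nthc j x))"
  unfolding evalr_def run_def by simp_all


section \<open>Correctness of the auxiliary functions\<close>

lemma run_opn_tm: "run \<Sigma> [OPN_TM, k, x, enc_tm M] = Some (enc_tm (opn_tm k x M))"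
  and run_opn_sp: "run \<Sigma> [OPN_SP, k, x, enc_sp S] = Some (enc_sp (opn_sp k x S))"
proof (induction M and S arbitrary: k and k)
  case (Neu H S)
  show ?case
  proof (cases H)
    case (Var v)
    then show ?thesis using Neu[of k]
      by (cases v; subst run_simps(5); simp add: opn_tm_body_def opn_var_exp_def Let_def)
  qed (subst run_simps(5); use Neu[of k] in \<open>simp add: opn_tm_body_def Let_def\<close>)+
next
  case (Lam M)
  then show ?case by (subst run_simps(5), simp add: opn_tm_body_def Let_def)
next
  case (SPre v S)
  then show ?case
    by (cases v; subst run_simps(6); simp add: opn_sp_body_def opn_var_exp_def Let_def)
qed (subst run_simps(6), simp add: opn_sp_body_def Let_def)+

primrec lookup :: "(name \<times> name) list \<Rightarrow> name \<Rightarrow> name" where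
  "lookup [] x = x"
| "lookup (p # \<sigma>) x = (if fst p = x then snd p else lookup \<sigma> x)"

definition enc_ren :: "(name \<times> name) list \<Rightarrow> nat" where
  "enc_ren \<sigma> = list_encode (map (\<lambda>(x, y). list_encode [x, y]) \<sigma>)"

lemma run_lookup: "run \<Sigma> [LOOKUP, enc_ren \<sigma>, x] = Some (lookup \<sigma> x)"
proof (induction \<sigma>)
  case (Cons p \<sigma>)
  then show ?case
    by (cases p; subst run_simps(7); simp add: lookup_body_def Let_def enc_ren_def)
qed (subst run_simps(7), simp add: lookup_body_def Let_def enc_ren_def)

lemma run_ren_tm: "run \<Sigma> [REN_TM, enc_ren \<sigma>, enc_tm M] = Some (enc_tm (ren_tm (lookup \<sigma>) M))"
  and run_ren_sp: "run \<Sigma> [REN_SP, enc_ren \<sigma>, enc_sp S] = Some (enc_sp (ren_sp (lookup \<sigma>) S))"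
proof (induction M and S)
  case (Neu H S)
  show ?case
  proof (cases H)
    case (Var v)
    then show ?thesis using Neu
      by (cases v; subst run_simps(8); simp add: ren_tm_body_def ren_var_exp_def Let_def run_lookup)
  qed (subst run_simps(8); use Neu in \<open>simp add: ren_tm_body_def Let_def\<close>)+
next
  case (Lam M)
  then show ?case by (subst run_simps(8), simp add: ren_tm_body_def Let_def)
next
  case (SPre v S)
  then show ?case
    by (cases v; subst run_simps(9); simp add: ren_sp_body_def ren_var_exp_def Let_def run_lookup)
qed (subst run_simps(9), simp add: ren_sp_body_def Let_def)+

lemma run_match_any:
  assumes "\<And>y. y \<in> set ys \<Longrightarrow>
    run \<Sigma> [MATCH, \<Theta>', \<Theta>, enc_ren ((x, y) # \<sigma>), N, N', M, M'] = Some (of_bool (P y))"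
  shows "run \<Sigma> [MATCH_ANY, list_encode ys, x, \<Theta>', \<Theta>, enc_ren \<sigma>, N, N', M, M']
    = Some (of_bool (\<exists>y \<in> set ys. P y))"
  using assms
proof (induction ys)
  case (Cons y ys)
  have "consc (list_encode [x, y]) (enc_ren \<sigma>) = enc_ren ((x, y) # \<sigma>)" by (simp add: enc_ren_def)
  then show ?case using Cons by (subst run_simps(11), simp add: match_any_body_def Let_def)
qed (subst run_simps(11), simp add: match_any_body_def Let_def)

text \<open>\<open>\<sigma>\<close> records the choices already made, and \<open>\<rho>\<close>
  ranges over their completions. When \<open>\<Theta>'\<close> is used up,
  \<open>lookup \<sigma>\<close> is the only one; at the start the empty \<open>\<sigma>\<close>
  means that variables outside \<open>\<Theta>'\<close> are left alone, as in
  \<open>renaming\<close>.\<close>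

lemma run_match:
  "run \<Sigma> [MATCH, list_encode \<Theta>', list_encode \<Theta>, enc_ren \<sigma>, enc_tm N, enc_tm N', enc_tm M, enc_tm M'] =
   Some (of_bool (\<exists>\<rho>. (\<forall>x \<in> set \<Theta>'. \<rho> x \<in> set \<Theta>) \<and> (\<forall>x. x \<notin> set \<Theta>' \<longrightarrow> \<rho> x = lookup \<sigma> x) \<and>
      ren_tm \<rho> N = M \<and> ren_tm \<rho> N' = M'))"
proof (induction \<Theta>' arbitrary: \<sigma>)
  case Nil
  have "(\<forall>x. \<rho> x = lookup \<sigma> x) \<longleftrightarrow> \<rho> = lookup \<sigma>" for \<rho> by auto
  then show ?case
    by (subst run_simps(10), simp add: match_body_def Let_def run_ren_tm enc_tm_inj)
next
  case (Cons x \<Theta>')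
  let ?P = "\<lambda>\<Theta>' \<sigma> \<rho>. (\<forall>x \<in> set \<Theta>'. \<rho> x \<in> set \<Theta>) \<and> (\<forall>x. x \<notin> set \<Theta>' \<longrightarrow> \<rho> x = lookup \<sigma> x) \<and>
      ren_tm \<rho> N = M \<and> ren_tm \<rho> N' = M'"
  have "(\<exists>y \<in> set \<Theta>. \<exists>\<rho>. ?P \<Theta>' ((x, y) # \<sigma>) \<rho>) \<longleftrightarrow> (\<exists>\<rho>. ?P (x # \<Theta>') \<sigma> \<rho>)"
  proof
    assume "\<exists>y \<in> set \<Theta>. \<exists>\<rho>. ?P \<Theta>' ((x, y) # \<sigma>) \<rho>"
    then obtain y \<rho> where "y \<in> set \<Theta>" "?P \<Theta>' ((x, y) # \<sigma>) \<rho>" by blast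
    \<comment> \<open>If \<open>x\<close> occurs again in \<open>\<Theta>'\<close>, a later choice
      overrides \<open>y\<close>; in either case \<open>\<rho> x\<close> is in
      \<open>\<Theta>\<close>.\<close>
    then have "?P (x # \<Theta>') \<sigma> \<rho>" by (cases "x \<in> set \<Theta>'") auto
    then show "\<exists>\<rho>. ?P (x # \<Theta>') \<sigma> \<rho>" by blast
  next
    assume "\<exists>\<rho>. ?P (x # \<Theta>') \<sigma> \<rho>"
    then obtain \<rho> where "?P (x # \<Theta>') \<sigma> \<rho>" by blast
    then have "\<rho> x \<in> set \<Theta>" "?P \<Theta>' ((x, \<rho> x) # \<sigma>) \<rho>" by auto
    then show "\<exists>y \<in> set \<Theta>. \<exists>\<rho>. ?P \<Theta>' ((x, y) # \<sigma>) \<rho>" by blast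
  qed
  then show ?case
    using run_match_any[of \<Theta> \<Sigma> "list_encode \<Theta>'" "list_encode \<Theta>" x \<sigma> "enc_tm N" "enc_tm N'" "enc_tm M"
        "enc_tm M'" "\<lambda>y. \<exists>\<rho>. ?P \<Theta>' ((x, y) # \<sigma>) \<rho>"] Cons.IH
    by (subst run_simps(10), simp add: match_body_def Let_def)
qed

lemma run_hit:
  "run \<Sigma> [HIT, list_encode (map enc_assm \<Delta>), list_encode \<Theta>, enc_tm M, enc_tm M'] =
   Some (of_bool (hit \<Delta> \<Theta> M M'))"
proof (induction \<Delta>)
  case Nil
  then show ?case by (subst run_simps(12), simp add: hit_body_def Let_def hit_def)
next
  case (Cons \<delta> \<Delta>)
  obtain \<Theta>' H S H' S' where \<delta>: "\<delta> = Assm \<Theta>' H S H' S'" by (cases \<delta>)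
  define Q where "Q \<longleftrightarrow> (\<exists>\<rho>. renaming \<Theta> \<rho> \<Theta>' \<and> ren_tm \<rho> (Neu H S) = M \<and> ren_tm \<rho> (Neu H' S') = M')"
  have "run \<Sigma> [MATCH, list_encode \<Theta>', list_encode \<Theta>, 0, enc_tm (Neu H S), enc_tm (Neu H' S'),
      enc_tm M, enc_tm M'] = Some (of_bool Q)"
    using run_match[of \<Sigma> \<Theta>' \<Theta> "[]" "Neu H S" "Neu H' S'" M M']
    by (simp add: Q_def renaming_def enc_ren_def del: ren_tm.simps enc_tm.simps)
  moreover have "hit (\<delta> # \<Delta>) \<Theta> M M' \<longleftrightarrow> Q \<or> hit \<Delta> \<Theta> M M'"
    unfolding hit_def Q_def \<delta> by (simp only: list.set insert_iff assm.inject) blast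
  ultimately show ?case
    using Cons.IH by (subst run_simps(12), simp add: hit_body_def Let_def \<delta>)
qed

lemma enc_sty_eq_0 [simp]: "enc_sty \<tau> = 0 \<longleftrightarrow> \<tau> = Base"
  by (cases \<tau>) auto

lemma run_unfold_sp:
  "run \<Sigma> [UNFOLD, enc_sp S, enc_sty \<tau>, enc_tm M] =
   Some (case unfold S \<tau> M of None \<Rightarrow> 0 | Some N \<Rightarrow> list_encode [enc_tm N])"
proof (induction S arbitrary: \<tau> M rule: spine_induct)
  case SNil
  then show ?case
    by (cases \<tau>; cases M; subst run_simps(13); simp add: unfold_body_def Let_def)
next
  case (SArg N S)
  then show ?case by (subst run_simps(13), simp add: unfold_body_def Let_def)
next
  case (SPre v S)
  then show ?case
    by (cases v; cases \<tau>; cases M; subst run_simps(13); simp add: unfold_body_def Let_def run_opn_tm split: sty.splits)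
qed

lemma run_snoc: "run \<Sigma> [SNOC, list_encode xs, x] = Some (list_encode (xs @ [x]))"
  by (induction xs) (subst run_simps(14), simp add: snoc_body_def Let_def)+

text \<open>The assumption is what the induction in \<open>run_eq\<close> supplies for the unfolded
  goals, with \<open>P N\<close> as their derivability; \<open>right\<close> tells on which side the
  unfolded term goes.\<close>

lemma run_try:
  assumes "\<And>r \<tau> M N. (r, \<tau>, M) \<in> set T \<Longrightarrow> unfold S \<tau> M = Some N \<Longrightarrow>
    run \<Sigma> (if right then [EQ_TM, \<Delta>, \<Theta>, L, enc_tm N] else [EQ_TM, \<Delta>, \<Theta>, enc_tm N, L]) = Some (of_bool (P N))"
  shows "run \<Sigma> [TRY, list_encode (map enc_entry T), r, enc_sp S, \<Delta>, \<Theta>, L, of_bool right] =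
    Some (of_bool (\<exists>\<tau> M N. (r, \<tau>, M) \<in> set T \<and> unfold S \<tau> M = Some N \<and> P N))"
  using assms
proof (induction T)
  case Nil
  then show ?case by (subst run_simps(17), simp add: try_body_def Let_def)
next
  case (Cons p T)
  obtain r' \<tau> M where p: "p = (r', \<tau>, M)" by (cases p)
  define Q where "Q \<longleftrightarrow> (\<exists>\<tau> M N. (r, \<tau>, M) \<in> set T \<and> unfold S \<tau> M = Some N \<and> P N)"
  have IH: "run \<Sigma> [TRY, list_encode (map enc_entry T), r, enc_sp S, \<Delta>, \<Theta>, L, of_bool right] = Some (of_bool Q)"
    unfolding Q_def by (rule Cons.IH, rule Cons.prems) auto
  have split: "(\<exists>\<tau> M N. (r, \<tau>, M) \<in> set (p # T) \<and> unfold S \<tau> M = Some N \<and> P N) \<longleftrightarrow>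
      (r' = r \<and> (\<exists>N. unfold S \<tau> M = Some N \<and> P N)) \<or> Q"
    unfolding Q_def p by auto
  have hd: "run \<Sigma> (if right then [EQ_TM, \<Delta>, \<Theta>, L, enc_tm N] else [EQ_TM, \<Delta>, \<Theta>, enc_tm N, L])
      = Some (of_bool (P N))" if "unfold S \<tau> M = Some N" for N
    by (rule Cons.prems[of r' \<tau> M]) (use that in \<open>simp_all add: p\<close>)
  have p': "enc_entry p = list_encode [r', enc_sty \<tau>, enc_tm M]" by (simp add: enc_entry_def p)
  show ?case
  proof (cases "unfold S \<tau> M")
    case None
    then show ?thesis unfolding split using IH
      by (subst run_simps(17), simp add: try_body_def Let_def run_unfold_sp p')
  next
    case (Some N)
    then show ?thesis unfolding split using IH hd[OF Some]
      by (cases right; subst run_simps(17); simp add: try_body_def Let_def run_unfold_sp p')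
  qed
qed


section \<open>Reading arbitrary numbers as codes\<close>

lemma evalr_norm_var:
  assumes "evalr \<Sigma> e xs = Some n"
  shows "\<exists>v. evalr \<Sigma> (norm_var e) xs = Some (enc_var v) \<and> (\<forall>v'. n = enc_var v' \<longrightarrow> v = v')"
proof -
  have "v = v'" if "n = enc_var v'" "v = (if hdc n = 0 then Free (nthc 1 n) else Bound (nthc 1 n))" for v v'
    using that by (cases v') auto
  moreover have "evalr \<Sigma> (norm_var e) xs =
      Some (enc_var (if hdc n = 0 then Free (nthc 1 n) else Bound (nthc 1 n)))"
    using assms by (simp add: norm_var_def)
  ultimately show ?thesis by blast
qed

lemma evalr_norm_head:
  assumes "evalr \<Sigma> e xs = Some n"
  shows "\<exists>H. evalr \<Sigma> (norm_head e) xs = Some (enc_head H) \<and> (\<forall>H'. n = enc_head H' \<longrightarrow> H = H')"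
proof -
  have "evalr \<Sigma> (efield 1 e) xs = Some (nthc 1 n)" using assms by simp
  from evalr_norm_var[OF this] obtain v where v:
    "evalr \<Sigma> (norm_var (efield 1 e)) xs = Some (enc_var v)" "\<And>v'. nthc 1 n = enc_var v' \<Longrightarrow> v = v'"
    by blast
  define H where "H = (if hdc n = 0 then Var v else if hdc n = 1 then Con (nthc 1 n) else Rec (nthc 1 n))"
  have "H = H'" if "n = enc_head H'" for H'
    using that v(2) by (cases H') (auto simp: H_def)
  moreover have "evalr \<Sigma> (norm_head e) xs = Some (enc_head H)"
    using assms v(1) by (simp add: norm_head_def H_def)
  ultimately show ?thesis by blast
qed

text \<open>Strong induction on the number rather than on a term, since the number may encode
  nothing; the fields of a nonzero number are smaller than it.\<close>

lemma run_norm: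
  "(\<exists>M. run \<Sigma> [NORM_TM, n] = Some (enc_tm M) \<and> (\<forall>M'. n = enc_tm M' \<longrightarrow> M = M')) \<and>
   (\<exists>S. run \<Sigma> [NORM_SP, n] = Some (enc_sp S) \<and> (\<forall>S'. n = enc_sp S' \<longrightarrow> S = S'))"
proof (induction n rule: less_induct)
  case (less n)
  have IH_tm: "\<exists>M. run \<Sigma> [NORM_TM, nthc j n] = Some (enc_tm M) \<and> (\<forall>M'. nthc j n = enc_tm M' \<longrightarrow> M = M')"
    and IH_sp: "\<exists>S. run \<Sigma> [NORM_SP, nthc j n] = Some (enc_sp S) \<and> (\<forall>S'. nthc j n = enc_sp S' \<longrightarrow> S = S')"
    if "n \<noteq> 0" for j
    using less.IH[OF nthc_less[OF that]] by blast+
  \<comment> \<open>Spines precede terms: on \<open>n = 0\<close> the term program passes on field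
    2, which is \<open>0\<close> again and not smaller. There the result for spines at
    \<open>n\<close> itself is used, where \<open>NORM_SP\<close> makes no call.\<close>
  have sp: "\<exists>S. run \<Sigma> [NORM_SP, n] = Some (enc_sp S) \<and> (\<forall>S'. n = enc_sp S' \<longrightarrow> S = S')"
  proof -
    consider "hdc n = 1" | "hdc n = 2" | "hdc n \<noteq> 1" "hdc n \<noteq> 2" by blast
    then show ?thesis
    proof cases
      case 1
      then have "n \<noteq> 0" by (cases "n = 0") auto
      obtain M where M: "run \<Sigma> [NORM_TM, nthc 1 n] = Some (enc_tm M)" "\<And>M'. nthc 1 n = enc_tm M' \<Longrightarrow> M = M'"
        using IH_tm[OF \<open>n \<noteq> 0\<close>] by blast
      obtain S where S: "run \<Sigma> [NORM_SP, nthc 2 n] = Some (enc_sp S)" "\<And>S'. nthc 2 n = enc_sp S' \<Longrightarrow> S = S'"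
        using IH_sp[OF \<open>n \<noteq> 0\<close>] by blast
      have "run \<Sigma> [NORM_SP, n] = Some (enc_sp (SArg M S))"
        using 1 M(1) S(1) by (subst run_simps(3), simp add: norm_sp_body_def Let_def)
      moreover have "SArg M S = S'" if "n = enc_sp S'" for S'
        using that 1 M(2) S(2) by (cases S') auto
      ultimately show ?thesis by blast
    next
      case 2
      then have "n \<noteq> 0" by (cases "n = 0") auto
      obtain S where S: "run \<Sigma> [NORM_SP, nthc 2 n] = Some (enc_sp S)" "\<And>S'. nthc 2 n = enc_sp S' \<Longrightarrow> S = S'"
        using IH_sp[OF \<open>n \<noteq> 0\<close>] by blast
      have "evalr \<Sigma> (efield 1 (earg 1)) [NORM_SP, n] = Some (nthc 1 n)" by simp
      from evalr_norm_var[OF this] obtain v where v: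
        "evalr \<Sigma> (norm_var (efield 1 (earg 1))) [NORM_SP, n] = Some (enc_var v)"
        "\<And>v'. nthc 1 n = enc_var v' \<Longrightarrow> v = v'" by blast
      have "run \<Sigma> [NORM_SP, n] = Some (enc_sp (SPre v S))"
        using 2 v(1) S(1) by (subst run_simps(3), simp add: norm_sp_body_def Let_def)
      moreover have "SPre v S = S'" if "n = enc_sp S'" for S'
        using that 2 v(2) S(2) by (cases S') auto
      ultimately show ?thesis by blast
    next
      case 3
      then have "run \<Sigma> [NORM_SP, n] = Some (enc_sp SNil)"
        by (subst run_simps(3), simp add: norm_sp_body_def Let_def)
      moreover have "SNil = S'" if "n = enc_sp S'" for S' using that 3 by (cases S') auto
      ultimately show ?thesis by blast
    qed
  qed
  have "\<exists>M. run \<Sigma> [NORM_TM, n] = Some (enc_tm M) \<and> (\<forall>M'. n = enc_tm M' \<longrightarrow> M = M')"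
  proof (cases "hdc n = 0")
    case False
    then have "n \<noteq> 0" by (metis hdc_0)
    obtain M where M: "run \<Sigma> [NORM_TM, nthc 1 n] = Some (enc_tm M)" "\<And>M'. nthc 1 n = enc_tm M' \<Longrightarrow> M = M'"
      using IH_tm[OF \<open>n \<noteq> 0\<close>] by blast
    have "run \<Sigma> [NORM_TM, n] = Some (enc_tm (Lam M))"
      using False M(1) by (subst run_simps(2), simp add: norm_tm_body_def Let_def)
    moreover have "Lam M = M'" if "n = enc_tm M'" for M'
      using that False M(2) by (cases M') auto
    ultimately show ?thesis by blast
  next
    case True
    have "\<exists>S. run \<Sigma> [NORM_SP, nthc 2 n] = Some (enc_sp S) \<and> (\<forall>S'. nthc 2 n = enc_sp S' \<longrightarrow> S = S')"
      using sp IH_sp by (cases "n = 0") (simp_all add: nthc_of_0)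
    then obtain S where S: "run \<Sigma> [NORM_SP, nthc 2 n] = Some (enc_sp S)"
      "\<And>S'. nthc 2 n = enc_sp S' \<Longrightarrow> S = S'" by blast
    have "evalr \<Sigma> (efield 1 (earg 1)) [NORM_TM, n] = Some (nthc 1 n)" by simp
    from evalr_norm_head[OF this] obtain H where H:
      "evalr \<Sigma> (norm_head (efield 1 (earg 1))) [NORM_TM, n] = Some (enc_head H)"
      "\<And>H'. nthc 1 n = enc_head H' \<Longrightarrow> H = H'" by blast
    have "run \<Sigma> [NORM_TM, n] = Some (enc_tm (Neu H S))"
      using True H(1) S(1) by (subst run_simps(2), simp add: norm_tm_body_def Let_def)
    moreover have "Neu H S = M'" if "n = enc_tm M'" for M'
      using that True H(2) S(2) by (cases M') auto
    ultimately show ?thesis by blast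
  qed
  with sp show ?case by blast
qed

lemma run_norm_assms:
  "\<exists>\<Delta>. run \<Sigma> [NORM_ASSMS, list_encode ns] = Some (list_encode (map enc_assm \<Delta>)) \<and>
     (\<forall>\<Delta>'. ns = map enc_assm \<Delta>' \<longrightarrow> \<Delta> = \<Delta>')"
proof (induction ns)
  case Nil
  have "run \<Sigma> [NORM_ASSMS, list_encode []] = Some (list_encode (map enc_assm []))"
    by (subst run_simps(4), simp add: norm_assms_body_def Let_def)
  then show ?case by blast
next
  case (Cons n ns)
  let ?xs = "[NORM_ASSMS, list_encode (n # ns)]"
  obtain \<Delta> where \<Delta>: "run \<Sigma> [NORM_ASSMS, list_encode ns] = Some (list_encode (map enc_assm \<Delta>))"
    "\<And>\<Delta>'. ns = map enc_assm \<Delta>' \<Longrightarrow> \<Delta> = \<Delta>'"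
    using Cons by blast
  have e: "evalr \<Sigma> (efield j (EHd (earg 1))) ?xs = Some (nthc j n)" for j by simp
  obtain H where H: "evalr \<Sigma> (norm_head (efield 1 (EHd (earg 1)))) ?xs = Some (enc_head H)"
    "\<And>H'. nthc 1 n = enc_head H' \<Longrightarrow> H = H'"
    using evalr_norm_head[OF e[of 1]] by blast
  obtain H2 where H2: "evalr \<Sigma> (norm_head (efield 3 (EHd (earg 1)))) ?xs = Some (enc_head H2)"
    "\<And>H'. nthc 3 n = enc_head H' \<Longrightarrow> H2 = H'"
    using evalr_norm_head[OF e[of 3]] by blast
  obtain S where S: "run \<Sigma> [NORM_SP, nthc 2 n] = Some (enc_sp S)" "\<And>S'. nthc 2 n = enc_sp S' \<Longrightarrow> S = S'"
    using run_norm[of \<Sigma> "nthc 2 n"] by blast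
  obtain S2 where S2: "run \<Sigma> [NORM_SP, nthc 4 n] = Some (enc_sp S2)" "\<And>S'. nthc 4 n = enc_sp S' \<Longrightarrow> S2 = S'"
    using run_norm[of \<Sigma> "nthc 4 n"] by blast
  define \<delta> where "\<delta> = Assm (list_decode (hdc n)) H S H2 S2"
  have "run \<Sigma> ?xs = Some (list_encode (map enc_assm (\<delta> # \<Delta>)))"
    using H(1) H2(1) S(1) S2(1) \<Delta>(1) by (subst run_simps(4), simp add: norm_assms_body_def Let_def \<delta>_def)
  moreover have "\<delta> # \<Delta> = \<Delta>'" if \<Delta>': "n # ns = map enc_assm \<Delta>'" for \<Delta>'
  proof -
    obtain \<delta>' \<Delta>'' where d: "\<Delta>' = \<delta>' # \<Delta>''" "n = enc_assm \<delta>'" "ns = map enc_assm \<Delta>''"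
      using \<Delta>' by (cases \<Delta>') auto
    then have "\<delta> = \<delta>'" using H(2) H2(2) S(2) S2(2) by (cases \<delta>') (simp add: \<delta>_def)
    then show ?thesis using d \<Delta>(2) by simp
  qed
  ultimately show ?case by blast
qed


section \<open>Correctness of the decision program\<close>

lemma fv_var_less: "x \<in> fv_var v \<Longrightarrow> x < enc_var v"
  by (cases v) (auto intro: list_encode_greater)

lemma fv_head_less: "x \<in> fv_head H \<Longrightarrow> x < enc_head H"
proof (cases H)
  case (Var v)
  assume "x \<in> fv_head H"
  then have "x < enc_var v" using Var fv_var_less by simp
  also have "\<dots> < enc_head H" using Var by (auto intro: list_encode_greater)
  finally show ?thesis .
qed auto

lemma fv_tm_less: "x \<in> fv_tm M \<Longrightarrow> x < enc_tm M"
  and fv_sp_less: "x \<in> fv_sp S \<Longrightarrow> x < enc_sp S"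
proof (induction M and S)
  case (Neu H S)
  have "enc_head H < enc_tm (Neu H S)" "enc_sp S < enc_tm (Neu H S)" by (auto intro: list_encode_greater)
  then show ?case using Neu fv_head_less by fastforce
next
  case (Lam M)
  have "enc_tm M < enc_tm (Lam M)" by (rule enc_tm_less_enc_tm)
  then show ?case using Lam by simp
next
  case (SArg M S)
  have "enc_tm M < enc_sp (SArg M S)" "enc_sp S < enc_sp (SArg M S)" by (auto intro: list_encode_greater)
  then show ?case using SArg by fastforce
next
  case (SPre v S)
  have "enc_var v < enc_sp (SPre v S)" "enc_sp S < enc_sp (SPre v S)" by (auto intro: list_encode_greater)
  then show ?case using SPre fv_var_less by fastforce
qed auto

lemma names_assm_less:
  assumes "x \<in> names_assm \<delta>"
  shows "x < enc_assm \<delta>"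
proof (cases \<delta>)
  case (Assm \<Theta> H S H' S')
  have "list_encode \<Theta> < enc_assm \<delta>" "enc_head H < enc_assm \<delta>" "enc_sp S < enc_assm \<delta>"
    "enc_head H' < enc_assm \<delta>" "enc_sp S' < enc_assm \<delta>"
    using Assm by (auto intro: list_encode_greater)
  moreover have "x < list_encode \<Theta> \<or> x < enc_head H \<or> x < enc_sp S \<or> x < enc_head H' \<or> x < enc_sp S'"
    using assms Assm list_encode_greater fv_head_less fv_sp_less by auto
  ultimately show ?thesis by linarith
qed

lemma finite_fv_sig: "finite (fv_sig \<Sigma>)"
proof -
  have "fv_sig \<Sigma> \<subseteq> (\<Union>d \<in> set \<Sigma>. case d of RecDecl r A M \<Rightarrow> fv_tm M | _ \<Rightarrow> {})"
    unfolding fv_sig_def by force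
  then show ?thesis by (rule finite_subset) (auto split: decl.split)
qed

lemma fresh_name:
  fixes \<Sigma> \<Delta> \<Theta> M M'
  defines "x \<equiv> list_encode [Max (insert 0 (fv_sig \<Sigma>)), list_encode (map enc_assm \<Delta>), list_encode \<Theta>,
    enc_tm (Lam M), enc_tm (Lam M')]"
  shows "x \<notin> set \<Theta>" "x \<notin> fv_tm M" "x \<notin> fv_tm M'" "x \<notin> (\<Union>\<delta> \<in> set \<Delta>. names_assm \<delta>)" "x \<notin> fv_sig \<Sigma>"
proof -
  have x: "Max (insert 0 (fv_sig \<Sigma>)) < x" "list_encode (map enc_assm \<Delta>) < x" "list_encode \<Theta> < x"
    "enc_tm (Lam M) < x" "enc_tm (Lam M') < x"
    unfolding x_def by (auto intro!: list_encode_greater simp del: enc_tm.simps)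
  show "x \<notin> set \<Theta>" using list_encode_greater[of x \<Theta>] x by auto
  show "x \<notin> fv_tm M" "x \<notin> fv_tm M'" using fv_tm_less[of x "Lam M"] fv_tm_less[of x "Lam M'"] x by auto
  show "x \<notin> (\<Union>\<delta> \<in> set \<Delta>. names_assm \<delta>)"
  proof
    assume "x \<in> (\<Union>\<delta> \<in> set \<Delta>. names_assm \<delta>)"
    then obtain \<delta> where \<delta>: "\<delta> \<in> set \<Delta>" "x < enc_assm \<delta>" using names_assm_less by blast
    then have "enc_assm \<delta> < list_encode (map enc_assm \<Delta>)" by (intro list_encode_greater) simp
    then show False using \<delta>(2) x(2) by linarith
  qed
  show "x \<notin> fv_sig \<Sigma>"
  proof
    assume "x \<in> fv_sig \<Sigma>"
    then have "x \<le> Max (insert 0 (fv_sig \<Sigma>))" using finite_fv_sig by (intro Max_ge) auto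
    then show False using x(1) by linarith
  qed
qed

lemma in_rec_table:
  "(r, \<tau>, M) \<in> set (rec_table \<Sigma>) \<longleftrightarrow> (\<exists>A. RecDecl r A M \<in> set \<Sigma> \<and> contra M \<and> \<tau> = erase A)"
  unfolding rec_table_def by (auto split: decl.splits if_splits)

text \<open>Lexicographic induction on the number of uncovered classes and the code of the left
  shape. Unfolding on either side lowers the first component; going under an abstraction or into a
  spine does not raise it and lowers the second. Boundedness by \<open>b\<close> and
  \<open>W\<close> is the invariant.\<close>

lemma run_eq:
  assumes W: "finite W"
    and sig: "\<And>r \<tau> M. (r, \<tau>, M) \<in> set (rec_table \<Sigma>) \<Longrightarrow> enc_tm (shape_tm M) \<le> b \<and> set (vars_tm M) \<subseteq> W"
  shows "bounded_tm b W \<Theta> M \<Longrightarrow> bounded_tm b W \<Theta> M' \<Longrightarrow>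
    run \<Sigma> [EQ_TM, list_encode (map enc_assm \<Delta>), list_encode \<Theta>, enc_tm M, enc_tm M']
    = Some (of_bool (eq_tm \<Sigma> \<Delta> \<Theta> M M'))"
proof -
  define ok_tm where "ok_tm \<Delta> \<Theta> M M' \<longleftrightarrow>
    run \<Sigma> [EQ_TM, list_encode (map enc_assm \<Delta>), list_encode \<Theta>, enc_tm M, enc_tm M']
    = Some (of_bool (eq_tm \<Sigma> \<Delta> \<Theta> M M'))" for \<Delta> \<Theta> M M'
  define ok_sp where "ok_sp \<Delta> \<Theta> S S' \<longleftrightarrow>
    run \<Sigma> [EQ_SP, list_encode (map enc_assm \<Delta>), list_encode \<Theta>, enc_sp S, enc_sp S']
    = Some (of_bool (eq_sp \<Sigma> \<Delta> \<Theta> S S'))" for \<Delta> \<Theta> S S'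
  \<comment> \<open>Terms and spines share one measure, because the code drops whenever the search
    passes from one kind to the other.\<close>
  define good where "good u s \<longleftrightarrow>
    (\<forall>\<Delta> \<Theta> M M'. bounded_tm b W \<Theta> M \<longrightarrow> bounded_tm b W \<Theta> M' \<longrightarrow> uncovered b W \<Delta> \<Theta> = u \<longrightarrow>
       enc_tm (shape_tm M) = s \<longrightarrow> ok_tm \<Delta> \<Theta> M M') \<and>
    (\<forall>\<Delta> \<Theta> S S'. bounded_sp b W \<Theta> S \<longrightarrow> bounded_sp b W \<Theta> S' \<longrightarrow> uncovered b W \<Delta> \<Theta> = u \<longrightarrow>
       enc_sp (shape_sp S) = s \<longrightarrow> ok_sp \<Delta> \<Theta> S S')" for u s
  have "good u s" for u s
  proof (induction u arbitrary: s rule: less_induct)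
    case (less u)
    note IH_u = less.IH
    show ?case
    proof (induction s rule: less_induct)
      case (less s)
      have tm_less: "ok_tm \<Delta> \<Theta> M M'"
        if "bounded_tm b W \<Theta> M" "bounded_tm b W \<Theta> M'" "uncovered b W \<Delta> \<Theta> < u" for \<Delta> \<Theta> M M'
        using IH_u[OF that(3), of "enc_tm (shape_tm M)"] that unfolding good_def by blast
      have sub: "good u' s'" if "u' \<le> u" "s' < s" for u' s'
        using IH_u[of u' s'] less.IH[of s'] that by (cases "u' = u") auto
      have tm_sub: "ok_tm \<Delta> \<Theta> M M'"
        if "bounded_tm b W \<Theta> M" "bounded_tm b W \<Theta> M'" "uncovered b W \<Delta> \<Theta> \<le> u"
          "enc_tm (shape_tm M) < s" for \<Delta> \<Theta> M M'
        using sub[OF that(3,4)] that unfolding good_def by blast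
      have sp_sub: "ok_sp \<Delta> \<Theta> S S'"
        if "bounded_sp b W \<Theta> S" "bounded_sp b W \<Theta> S'" "uncovered b W \<Delta> \<Theta> \<le> u"
          "enc_sp (shape_sp S) < s" for \<Delta> \<Theta> S S'
        using sub[OF that(3,4)] that unfolding good_def by blast
      have "ok_tm \<Delta> \<Theta> M M'"
        if M: "bounded_tm b W \<Theta> M" "bounded_tm b W \<Theta> M'" and u: "uncovered b W \<Delta> \<Theta> = u"
          and s: "enc_tm (shape_tm M) = s" for \<Delta> \<Theta> M M'
      proof (cases M)
        case (Lam N)
        show ?thesis
        proof (cases M')
          case (Lam N')
          define x where "x = list_encode [Max (insert 0 (fv_sig \<Sigma>)), list_encode (map enc_assm \<Delta>),
            list_encode \<Theta>, enc_tm (Lam N), enc_tm (Lam N')]"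
          have "ok_tm \<Delta> (\<Theta> @ [x]) (opn_tm 0 x N) (opn_tm 0 x N')"
          proof (rule tm_sub)
            show "bounded_tm b W (\<Theta> @ [x]) (opn_tm 0 x N)" "bounded_tm b W (\<Theta> @ [x]) (opn_tm 0 x N')"
              using M \<open>M = Lam N\<close> Lam bounded_tm_opn by auto
            show "uncovered b W \<Delta> (\<Theta> @ [x]) \<le> u" unfolding u[symmetric] by (rule uncovered_mono[OF W]) auto
            show "enc_tm (shape_tm (opn_tm 0 x N)) < s"
              using s \<open>M = Lam N\<close> enc_tm_less_enc_tm[of "shape_tm N"] by simp
          qed
          then have "run \<Sigma> [EQ_TM, list_encode (map enc_assm \<Delta>), list_encode (\<Theta> @ [x]),
              enc_tm (opn_tm 0 x N), enc_tm (opn_tm 0 x N')] = Some (of_bool (eq_tm \<Sigma> \<Delta> \<Theta> M M'))"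
            unfolding ok_tm_def \<open>M = Lam N\<close> Lam x_def using eq_tm_Lam_iff[OF fresh_name] by simp
          then show ?thesis
            unfolding ok_tm_def \<open>M = Lam N\<close> Lam
            by (subst run_simps(15), simp add: eq_tm_body_def Let_def x_def run_snoc run_opn_tm)
        next
          case (Neu H S)
          then show ?thesis
            unfolding ok_tm_def \<open>M = Lam N\<close> Neu
            by (subst run_simps(15), simp add: eq_tm_body_def Let_def)
        qed
      next
        case (Neu H S)
        show ?thesis
        proof (cases M')
          case (Lam N')
          then show ?thesis
            unfolding ok_tm_def \<open>M = Neu H S\<close> Lam
            by (subst run_simps(15), simp add: eq_tm_body_def Let_def)
        next
          case (Neu H' S')
          note eqs = \<open>M = Neu H S\<close> \<open>M' = Neu H' S'\<close>
          note hit = run_hit[of \<Sigma> \<Delta> \<Theta> "Neu H S" "Neu H' S'", simplified]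
          show ?thesis
          proof (cases "hit \<Delta> \<Theta> M M'")
            case True
            then show ?thesis
              unfolding ok_tm_def eqs using eq_tm_hit hit
              by (subst run_simps(15), simp add: eq_tm_body_def Let_def)
          next
            case False
            let ?\<Delta> = "\<Delta> @ [Assm \<Theta> H S H' S']"
            \<comment> \<open>This is where testing the assumptions before unfolding pays off: the
              failed test makes the new assumption cover a new class.\<close>
            have less: "uncovered b W ?\<Delta> \<Theta> < u"
              using uncovered_less[OF W] M False unfolding eqs u[symmetric] by blast
            consider (left) r where "H = Rec r" | (right) r where "\<And>r. H \<noteq> Rec r" "H' = Rec r"
              | (rigid) "\<And>r. H \<noteq> Rec r" "\<And>r. H' \<noteq> Rec r" by metis
            then show ?thesis
            proof cases
              case left
              have "run \<Sigma> [TRY, list_encode (map enc_entry (rec_table \<Sigma>)), r, enc_sp S,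
                  list_encode (map enc_assm ?\<Delta>), list_encode \<Theta>, enc_tm M', of_bool False] =
                Some (of_bool (\<exists>\<tau> L N. (r, \<tau>, L) \<in> set (rec_table \<Sigma>) \<and> unfold S \<tau> L = Some N \<and>
                  eq_tm \<Sigma> ?\<Delta> \<Theta> N M'))"
              proof (rule run_try)
                fix r' \<tau> L N assume L: "(r', \<tau>, L) \<in> set (rec_table \<Sigma>)" "unfold S \<tau> L = Some N"
                have "bounded_tm b W \<Theta> N"
                  using bounded_unfold[OF L(2)] sig[OF L(1)] M(1) eqs(1) by blast
                from tm_less[OF this M(2) less]
                show "run \<Sigma> (if False then [EQ_TM, list_encode (map enc_assm ?\<Delta>), list_encode \<Theta>,
                    enc_tm M', enc_tm N] else [EQ_TM, list_encode (map enc_assm ?\<Delta>), list_encode \<Theta>,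
                    enc_tm N, enc_tm M']) = Some (of_bool (eq_tm \<Sigma> ?\<Delta> \<Theta> N M'))"
                  unfolding ok_tm_def by simp
              qed
              also have "(\<exists>\<tau> L N. (r, \<tau>, L) \<in> set (rec_table \<Sigma>) \<and> unfold S \<tau> L = Some N \<and>
                  eq_tm \<Sigma> ?\<Delta> \<Theta> N M') \<longleftrightarrow> eq_tm \<Sigma> \<Delta> \<Theta> M M'"
                using False eq_tm_Rec_left_iff[of \<Sigma> \<Delta> \<Theta> r S H' S'] unfolding eqs left in_rec_table by blast
              finally show ?thesis
                unfolding ok_tm_def eqs left using hit False unfolding eqs left
                by (subst run_simps(15), simp add: eq_tm_body_def Let_def run_snoc)
            next
              case right
              have "run \<Sigma> [TRY, list_encode (map enc_entry (rec_table \<Sigma>)), r, enc_sp S',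
                  list_encode (map enc_assm ?\<Delta>), list_encode \<Theta>, enc_tm M, of_bool True] =
                Some (of_bool (\<exists>\<tau> L N. (r, \<tau>, L) \<in> set (rec_table \<Sigma>) \<and> unfold S' \<tau> L = Some N \<and>
                  eq_tm \<Sigma> ?\<Delta> \<Theta> M N))"
              proof (rule run_try)
                fix r' \<tau> L N assume L: "(r', \<tau>, L) \<in> set (rec_table \<Sigma>)" "unfold S' \<tau> L = Some N"
                have "bounded_tm b W \<Theta> N"
                  using bounded_unfold[OF L(2)] sig[OF L(1)] M(2) eqs(2) by blast
                \<comment> \<open>The left term is unchanged here and the right one may have grown,
                  so only the count of uncovered classes decreases.\<close>
                from tm_less[OF M(1) this less]
                show "run \<Sigma> (if True then [EQ_TM, list_encode (map enc_assm ?\<Delta>), list_encode \<Theta>,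
                    enc_tm M, enc_tm N] else [EQ_TM, list_encode (map enc_assm ?\<Delta>), list_encode \<Theta>,
                    enc_tm N, enc_tm M]) = Some (of_bool (eq_tm \<Sigma> ?\<Delta> \<Theta> M N))"
                  unfolding ok_tm_def by simp
              qed
              also have "(\<exists>\<tau> L N. (r, \<tau>, L) \<in> set (rec_table \<Sigma>) \<and> unfold S' \<tau> L = Some N \<and>
                  eq_tm \<Sigma> ?\<Delta> \<Theta> M N) \<longleftrightarrow> eq_tm \<Sigma> \<Delta> \<Theta> M M'"
                using False eq_tm_Rec_right_iff[OF right(1), of \<Sigma> \<Delta> \<Theta> S r S']
                unfolding eqs right(2) in_rec_table by blast
              finally show ?thesis
                unfolding ok_tm_def eqs right(2) using hit False right(1) unfolding eqs right(2)
                by (cases H; subst run_simps(15); simp add: eq_tm_body_def Let_def run_snoc)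
            next
              case rigid
              have "ok_sp \<Delta> \<Theta> S S'"
              proof (rule sp_sub)
                show "bounded_sp b W \<Theta> S" "bounded_sp b W \<Theta> S'" using M eqs bounded_Neu by auto
                show "enc_sp (shape_sp S) < s"
                  using s eqs enc_sp_less_enc_tm[of "shape_sp S" "shape_head H"] by simp
              qed (simp add: u)
              then have sp: "run \<Sigma> [EQ_SP, list_encode (map enc_assm \<Delta>), list_encode \<Theta>, enc_sp S, enc_sp S']
                  = Some (of_bool (eq_sp \<Sigma> \<Delta> \<Theta> S S'))" unfolding ok_sp_def .
              note iff = eq_tm_rigid_iff[OF rigid, of \<Sigma> \<Delta> \<Theta> S S']
              show ?thesis
              proof (cases "H = H'")
                case True
                show ?thesis
                proof (cases H)
                  case (Var v)
                  with True have "H' = Var v" by simp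
                  with Var show ?thesis
                    unfolding ok_tm_def eqs iff using hit False sp unfolding eqs
                    by (cases v; subst run_simps(15); simp add: eq_tm_body_def Let_def)
                next
                  case (Con c)
                  with True have "H' = Con c" by simp
                  with Con show ?thesis
                    unfolding ok_tm_def eqs iff using hit False sp unfolding eqs
                    by (subst run_simps(15), simp add: eq_tm_body_def Let_def)
                qed (use rigid in simp)
              next
                case False
                \<comment> \<open>Tag 2 marks recursion constants, so the program reaches the
                  comparison of heads, where it fails.\<close>
                have "hdc (enc_head H) \<noteq> 2" "hdc (enc_head H') \<noteq> 2"
                  using rigid by (cases H; cases H'; simp)+
                then show ?thesis
                  unfolding ok_tm_def eqs iff using hit \<open>\<not> hit \<Delta> \<Theta> M M'\<close> False unfolding eqs
                  by (subst run_simps(15), simp add: eq_tm_body_def Let_def enc_head_inj)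
              qed
            qed
          qed
        qed
      qed
      moreover have "ok_sp \<Delta> \<Theta> S S'"
        if S: "bounded_sp b W \<Theta> S" "bounded_sp b W \<Theta> S'" and u: "uncovered b W \<Delta> \<Theta> = u"
          and s: "enc_sp (shape_sp S) = s" for \<Delta> \<Theta> S S'
      proof (cases S)
        case SNil
        then show ?thesis unfolding ok_sp_def
          by (cases S'; subst run_simps(16); simp add: eq_sp_body_def Let_def eq_sp_simps)
      next
        case (SArg N T)
        show ?thesis
        proof (cases S')
          case (SArg N' T')
          have "ok_tm \<Delta> \<Theta> N N'" "ok_sp \<Delta> \<Theta> T T'"
            using S bounded_SArg \<open>S = SArg N T\<close> SArg u s enc_tm_less_enc_sp[of "shape_tm N" "shape_sp T"]
              enc_sp_less_enc_sp(1)[of "shape_sp T" "shape_tm N"]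
            by (auto intro!: tm_sub sp_sub simp del: enc_sp.simps)
          then show ?thesis
            unfolding ok_sp_def ok_tm_def \<open>S = SArg N T\<close> SArg
            by (subst run_simps(16), simp add: eq_sp_body_def Let_def eq_sp_simps)
        qed (unfold ok_sp_def \<open>S = SArg N T\<close>, (subst run_simps(16), simp add: eq_sp_body_def Let_def eq_sp_simps)+)
      next
        case (SPre v T)
        show ?thesis
        proof (cases S')
          case (SPre v' T')
          have "ok_sp \<Delta> \<Theta> T T'"
            using S bounded_SPre \<open>S = SPre v T\<close> SPre u s enc_sp_less_enc_sp(2)[of "shape_sp T" "Free 0"]
            by (auto intro!: sp_sub simp del: enc_sp.simps)
          then show ?thesis
            unfolding ok_sp_def \<open>S = SPre v T\<close> SPre
            by (cases v; cases v'; subst run_simps(16);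
                simp add: eq_sp_body_def Let_def eq_sp_simps list_encode_eq)
        qed (unfold ok_sp_def \<open>S = SPre v T\<close>, (subst run_simps(16), simp add: eq_sp_body_def Let_def eq_sp_simps)+)
      qed
      ultimately show ?case unfolding good_def by blast
    qed
  qed
  then show "bounded_tm b W \<Theta> M \<Longrightarrow> bounded_tm b W \<Theta> M' \<Longrightarrow> ?thesis"
    unfolding good_def ok_tm_def by blast
qed

text \<open>The parameters \<open>b\<close> and \<open>W\<close> are read off the two terms and the
  definitions. Assumptions in \<open>\<Delta>\<close> with other variables do not count as covering
  a class; they can only make \<open>hit\<close> succeed more often.\<close>

lemma run_eq_tm:
  "run \<Sigma> [EQ_TM, list_encode (map enc_assm \<Delta>), list_encode \<Theta>, enc_tm M, enc_tm M']
   = Some (of_bool (eq_tm \<Sigma> \<Delta> \<Theta> M M'))"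
proof -
  define Ms where "Ms = insert M (insert M' ((snd \<circ> snd) ` set (rec_table \<Sigma>)))"
  define b where "b = Max (enc_tm ` shape_tm ` Ms)"
  define W where "W = (\<Union>N \<in> Ms. set (vars_tm N))"
  have "finite Ms" by (simp add: Ms_def)
  then have b: "enc_tm (shape_tm N) \<le> b" if "N \<in> Ms" for N
    unfolding b_def using that by (intro Max_ge) auto
  have W: "set (vars_tm N) \<subseteq> W" if "N \<in> Ms" for N unfolding W_def using that by blast
  have "finite W" using \<open>finite Ms\<close> by (simp add: W_def)
  then show ?thesis
  proof (rule run_eq)
    show "bounded_tm b W \<Theta> M" "bounded_tm b W \<Theta> M'"
      unfolding bounded_tm_def using b W by (auto simp: Ms_def)
  next
    fix r \<tau> N assume "(r, \<tau>, N) \<in> set (rec_table \<Sigma>)"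
    then have "N \<in> Ms" unfolding Ms_def by force
    then show "enc_tm (shape_tm N) \<le> b \<and> set (vars_tm N) \<subseteq> W" using b W by blast
  qed
qed

section \<open>Totality and correctness of the whole program\<close>

text \<open>Normalization turns the fields of any number into genuine codes of assumptions and
  terms, every number is a list of names, and \<open>run_eq_tm\<close> answers for all
  terms.\<close>

lemma run_main_total: "run \<Sigma> [MAIN, n] \<noteq> None"
proof -
  obtain \<Delta> where \<Delta>: "run \<Sigma> [NORM_ASSMS, hdc n] = Some (list_encode (map enc_assm \<Delta>))"
    using run_norm_assms[of \<Sigma> "list_decode (hdc n)"] by auto
  obtain M where M: "run \<Sigma> [NORM_TM, nthc 2 n] = Some (enc_tm M)"
    using run_norm[of \<Sigma> "nthc 2 n"] by blast
  obtain M' where M': "run \<Sigma> [NORM_TM, nthc 3 n] = Some (enc_tm M')"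
    using run_norm[of \<Sigma> "nthc 3 n"] by blast
  show ?thesis
    using \<Delta> M M' run_eq_tm[of \<Sigma> \<Delta> "list_decode (nthc 1 n)" M M']
    by (subst run_simps(1), simp add: main_body_def Let_def)
qed

lemma run_main_instance:
  "run \<Sigma> [MAIN, enc_instance (\<Delta>, \<Theta>, M, M')] = Some (of_bool (eq_tm \<Sigma> \<Delta> \<Theta> M M'))"
proof -
  have "run \<Sigma> [NORM_ASSMS, list_encode (map enc_assm \<Delta>)] = Some (list_encode (map enc_assm \<Delta>))"
    using run_norm_assms[of \<Sigma> "map enc_assm \<Delta>"] by auto
  moreover have "run \<Sigma> [NORM_TM, enc_tm N] = Some (enc_tm N)" for N
    using run_norm[of \<Sigma> "enc_tm N"] by auto
  ultimately show ?thesis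
    using run_eq_tm[of \<Sigma> \<Delta> \<Theta> M M'] by (subst run_simps(1), simp add: main_body_def Let_def)
qed

theorem theorem1:
  fixes \<Sigma> :: sig
  assumes "signature \<Sigma>"
  shows "decidable_on enc_instance
           {(\<Delta>, \<Theta>, M, M'). (\<forall>\<delta> \<in> set \<Delta>. assm_ok \<delta>) \<and> distinct \<Theta> \<and> rational \<Sigma> M \<and> rational \<Sigma> M'}
           (\<lambda>(\<Delta>, \<Theta>, M, M'). eq_tm \<Sigma> \<Delta> \<Theta> M M')"
proof -
  let ?f = "\<lambda>xs. the (run \<Sigma> [MAIN, xs ! 0])"
  have "recursive 1 (\<lambda>xs. list_encode [MAIN, xs ! 0])"
    unfolding list_encode_Cons list_encode_Nil
    by (intro recursive_consc recursive_const rec_proj) simp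
  then have "recursive 1 ?f"
    unfolding run_def by (rule recursive_sem) (use run_main_total in \<open>simp add: run_def\<close>)
  moreover have "?f [enc_instance (\<Delta>, \<Theta>, M, M')] = (if eq_tm \<Sigma> \<Delta> \<Theta> M M' then 1 else 0)" for \<Delta> \<Theta> M M'
    by (simp add: run_main_instance del: enc_instance.simps)
  ultimately show ?thesis
    unfolding decidable_on_def by (intro exI[of _ ?f]) (auto simp del: enc_instance.simps)
qed

end
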